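(* Let $C$ be a bounded chain complex of finitely generated free abelian groups, concentrated in nonnegative degrees. Write $$H_j(C;\mathbb Z)\cong\mathbb Z^{\beta_j}\oplus\bigoplus_{i=1}^{s_j}\mathbb Z/d_{j,i},\qquad 2\le d_{j,1}\mid\cdots\mid d_{j,s_j},$$ and let $r_k=\operatorname{rank}_{\mathbb Q}(\partial_k\otimes\mathbb Q)$. Then, after integral changes of basis (that is, up to isomorphism of chain complexes of abelian groups), $$C\cong\bigoplus_{j\ge0}\mathbb Z[j]^{\oplus\beta_j}\oplus\bigoplus_{k\ge1}\left(\bigoplus_{i=1}^{s_{k-1}}T_k(d_{k-1,i})\oplus T_k(1)^{\oplus(r_k-s_{k-1})}\right).$$
   Context: $\partial_k:C_k\to C_{k-1}$ denotes the differential of $C$. $\mathbb Z[j]$ is the complex with $\mathbb Z$ in degree $j$ and zero elsewhere. For $k\ge1$ and $d\in\mathbb Z_{>0}$, $T_k(d)$ is the complex $0\leftarrow\mathbb Z e_{k-1}\xleftarrow{d}\mathbb Z e_k\leftarrow0$ concentrated in degrees $k-1,k$, with differential multiplication by $d$. *)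

theory Defs
  imports
    "HOL-Algebra.Free_Abelian_Groups"
    "Jordan_Normal_Form.VS_Connect"
begin

section \<open>Chain complexes of abelian groups\<close>

text \<open>Complexes are indexed by all integers; \<open>bd C k\<close> is the differential from degree \<open>k\<close>
  to degree \<open>k - 1\<close>. The groups of all degrees share one element type, but are unrelated.\<close>

record 'a chain_cx =
  grp :: "int \<Rightarrow> 'a monoid"
  bd :: "int \<Rightarrow> 'a \<Rightarrow> 'a"

definition chain_complex :: "'a chain_cx \<Rightarrow> bool" where
  "chain_complex C \<longleftrightarrow>
     (\<forall>k. comm_group (grp C k)) \<and>
     (\<forall>k. bd C k \<in> hom (grp C k) (grp C (k - 1))) \<and>
     (\<forall>k. \<forall>x \<in> carrier (grp C k). bd C (k - 1) (bd C k x) = \<one>\<^bsub>grp C (k - 2)\<^esub>)"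

definition nonneg_complex :: "'a chain_cx \<Rightarrow> bool" where
  "nonneg_complex C \<longleftrightarrow> (\<forall>k<0. trivial_group (grp C k))"

definition bounded_complex :: "'a chain_cx \<Rightarrow> bool" where
  "bounded_complex C \<longleftrightarrow> (\<exists>m n. \<forall>k. k < m \<or> n < k \<longrightarrow> trivial_group (grp C k))"

definition fg_free_abelian :: "'a monoid \<Rightarrow> bool" where
  "fg_free_abelian G \<longleftrightarrow> (\<exists>n::nat. G \<cong> free_Abelian_group {..<n})"

definition cycles :: "'a chain_cx \<Rightarrow> int \<Rightarrow> 'a set" where
  "cycles C k = kernel (grp C k) (grp C (k - 1)) (bd C k)"

definition boundaries :: "'a chain_cx \<Rightarrow> int \<Rightarrow> 'a set" where
  "boundaries C k = bd C (k + 1) ` carrier (grp C (k + 1))"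

definition homology :: "'a chain_cx \<Rightarrow> int \<Rightarrow> 'a set monoid" where
  "homology C k = (grp C k)\<lparr>carrier := cycles C k\<rparr> Mod boundaries C k"

definition chain_iso :: "'a chain_cx \<Rightarrow> 'b chain_cx \<Rightarrow> (int \<Rightarrow> 'a \<Rightarrow> 'b) set" where
  "chain_iso C D = {f. (\<forall>k. f k \<in> iso (grp C k) (grp D k)) \<and>
     (\<forall>k. \<forall>x \<in> carrier (grp C k). f (k - 1) (bd C k x) = bd D k (f k x))}"

definition chain_isomorphic :: "'a chain_cx \<Rightarrow> 'b chain_cx \<Rightarrow> bool"
    (infix \<open>\<cong>\<^sub>c\<close> 50) where
  "C \<cong>\<^sub>c D \<longleftrightarrow> chain_iso C D \<noteq> {}"


section \<open>Direct sums and elementary complexes\<close>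

definition sum_complex :: "'i set \<Rightarrow> ('i \<Rightarrow> 'a chain_cx) \<Rightarrow> ('i \<Rightarrow> 'a) chain_cx" where
  "sum_complex I F =
     \<lparr>grp = (\<lambda>k. sum_group I (\<lambda>i. grp (F i) k)),
      bd = (\<lambda>k x. \<lambda>i\<in>I. bd (F i) k (x i))\<rparr>"

definition add_complex :: "'a chain_cx \<Rightarrow> 'b chain_cx \<Rightarrow> ('a \<times> 'b) chain_cx"
    (infixr \<open>\<oplus>\<^sub>c\<close> 65) where
  "C \<oplus>\<^sub>c D =
     \<lparr>grp = (\<lambda>k. grp C k \<times>\<times> grp D k),
      bd = (\<lambda>k (x, y). (bd C k x, bd D k y))\<rparr>"

definition copies :: "nat \<Rightarrow> 'a chain_cx \<Rightarrow> (nat \<Rightarrow> 'a) chain_cx" where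
  "copies n C = sum_complex {1..n} (\<lambda>_. C)"

definition Z_complex :: "int \<Rightarrow> int chain_cx" where
  "Z_complex j =
     \<lparr>grp = (\<lambda>k. if k = j then integer_group else singleton_group 0),
      bd = (\<lambda>k x. 0)\<rparr>"

definition T_complex :: "int \<Rightarrow> nat \<Rightarrow> int chain_cx" where
  "T_complex k d =
     \<lparr>grp = (\<lambda>l. if l = k - 1 \<or> l = k then integer_group else singleton_group 0),
      bd = (\<lambda>l x. if l = k then int d * x else 0)\<rparr>"


section \<open>Tensor products of abelian groups and the rational rank\<close>

definition tensor_relators ::
    "'a monoid \<Rightarrow> 'b monoid \<Rightarrow> ('a \<times> 'b \<Rightarrow>\<^sub>0 int) set" where
  "tensor_relators A B =
     {frag_of (a \<otimes>\<^bsub>A\<^esub> a', b) - frag_of (a, b) - frag_of (a', b) | a a' b.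
        a \<in> carrier A \<and> a' \<in> carrier A \<and> b \<in> carrier B} \<union>
     {frag_of (a, b \<otimes>\<^bsub>B\<^esub> b') - frag_of (a, b) - frag_of (a, b') | a b b'.
        a \<in> carrier A \<and> b \<in> carrier B \<and> b' \<in> carrier B}"

definition tensor_kernel ::
    "'a monoid \<Rightarrow> 'b monoid \<Rightarrow> ('a \<times> 'b \<Rightarrow>\<^sub>0 int) set" where
  "tensor_kernel A B =
     generate (free_Abelian_group (carrier A \<times> carrier B)) (tensor_relators A B)"

definition tensor_group ::
    "'a monoid \<Rightarrow> 'b monoid \<Rightarrow> ('a \<times> 'b \<Rightarrow>\<^sub>0 int) set monoid" where
  "tensor_group A B =
     free_Abelian_group (carrier A \<times> carrier B) Mod tensor_kernel A B"

text \<open>The homomorphism \<open>f \<otimes> g\<close> into the tensor product of \<open>A'\<close> and \<open>B'\<close>. Its argument \<open>X\<close> is a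
  coset; all of its elements \<open>x\<close> yield the same coset in the union.\<close>

definition tensor_map ::
    "'c monoid \<Rightarrow> 'd monoid \<Rightarrow> ('a \<Rightarrow> 'c) \<Rightarrow> ('b \<Rightarrow> 'd) \<Rightarrow>
     ('a \<times> 'b \<Rightarrow>\<^sub>0 int) set \<Rightarrow> ('c \<times> 'd \<Rightarrow>\<^sub>0 int) set" where
  "tensor_map A' B' f g X =
     (\<Union>x\<in>X. tensor_kernel A' B' #>\<^bsub>free_Abelian_group (carrier A' \<times> carrier B')\<^esub>
        frag_extend (\<lambda>(a, b). frag_of (f a, g b)) x)"

abbreviation rat_group :: "rat monoid" where
  "rat_group \<equiv> add_monoid class_ring"

text \<open>The rational vector space \<open>A \<otimes> \<rat>\<close>. The ring multiplication and unit, which the record type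
  of modules inherits from rings, are irrelevant.\<close>

definition rationalization ::
    "'a monoid \<Rightarrow> (rat, ('a \<times> rat \<Rightarrow>\<^sub>0 int) set) module" where
  "rationalization A =
     \<lparr>carrier = carrier (tensor_group A rat_group),
      monoid.mult = undefined, one = undefined,
      zero = \<one>\<^bsub>tensor_group A rat_group\<^esub>,
      add = monoid.mult (tensor_group A rat_group),
      smult = (\<lambda>q. tensor_map A rat_group (\<lambda>a. a) (\<lambda>x. q * x))\<rparr>"

text \<open>The rank of \<open>f \<otimes> \<rat>\<close> for a homomorphism \<open>f\<close> from \<open>A\<close> to \<open>B\<close>: the dimension of its image.\<close>

definition rational_rank :: "'a monoid \<Rightarrow> 'b monoid \<Rightarrow> ('a \<Rightarrow> 'b) \<Rightarrow> nat" where
  "rational_rank A B f =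
     vectorspace.dim (class_ring :: rat ring)
       ((rationalization B)\<lparr>carrier :=
          tensor_map B rat_group f (\<lambda>x. x) ` carrier (rationalization A)\<rparr>)"

end

theory Submission
  imports Defs
begin

text \<open>The whole decomposition comes from the Smith normal form, applied twice in each degree. Applied to
  \<open>\<partial>\<^sub>k\<close> as a map into \<open>C\<^sub>k\<^sub>-\<^sub>1\<close>, it shows that the group of cycles \<open>Z\<^sub>k\<close> is free and is a direct
  summand of \<open>C\<^sub>k\<close>. Since \<open>\<partial>\<^sub>k\<close> takes values in \<open>Z\<^sub>k\<^sub>-\<^sub>1\<close>, it can then be applied to
  \<open>\<partial>\<^sub>k\<close> as a map into \<open>Z\<^sub>k\<^sub>-\<^sub>1\<close>. This gives a basis \<open>x\<^sub>i\<close> of a complement of \<open>Z\<^sub>k\<close> and a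
  basis \<open>e\<^sub>i\<close> of \<open>Z\<^sub>k\<^sub>-\<^sub>1\<close> with \<open>\<partial> x\<^sub>i = a\<^sub>i e\<^sub>i\<close> and \<open>a\<^sub>i\<close> dividing \<open>a\<^sub>i\<^sub>+\<^sub>1\<close>.
  The bases of \<open>Z\<^sub>k\<close> that come from degree \<open>k + 1\<close> and of the complement that come from degree
  \<open>k\<close> do not interfere, so together they form one basis of \<open>C\<^sub>k\<close>, and all degrees fit together
  (\<open>complex_normal_form\<close>, and \<open>smith_form_exists\<close> for the given complex).

  In such a basis, \<open>C\<close> is visibly a sum of complexes \<open>T\<^sub>k(a\<^sub>i)\<close> and \<open>\<int>[j]\<close>; it remains to count them
  in terms of the given data. The homology in degree \<open>k - 1\<close> is the sum of the \<open>\<int>/a\<^sub>i\<close> and a free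
  group. The uniqueness of invariant factors (\<open>presents_unique\<close>) identifies the \<open>a\<^sub>i\<close> other than 1
  with the given torsion coefficients, and the free rank with the given Betti number
  (\<open>homology_determines\<close>). It is proved by counting: a sum of groups \<open>\<int>/c\<^sub>i\<close>, taken
  modulo its \<open>m\<close>-th multiples, has \<open>\<Prod> gcd(m, c\<^sub>i)\<close> elements for \<open>m > 0\<close>, and these numbers for all
  \<open>m\<close> determine a divisor chain. Finally, the number of all \<open>a\<^sub>i\<close> is the rational rank of \<open>\<partial>\<^sub>k\<close> (\<open>rational_rank_bd\<close>): with
  a basis, \<open>A \<otimes> \<rat>\<close> is the space of rational coordinate vectors, and there \<open>\<partial>\<^sub>k\<close> is the
  diagonal map with the nonzero entries \<open>a\<^sub>i\<close>.

  Free abelian groups and cyclic decompositions are handled uniformly by coordinates: a group is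
  described by an additive map from integer sequences onto it, together with its kernel
  (\<open>presents\<close>). Two groups described in the same way are isomorphic, compatibly with the
  coordinates, and this yields the isomorphism of complexes from a computation in
  coordinates (\<open>presents_coeff_elem\<close>, \<open>bd_coeff_elem\<close>).\<close>

section \<open>Integer combinations and bases\<close>

text \<open>Families are total functions on the naturals of which only the first \<open>n\<close> values count. This
  makes reindexing and concatenation of bases statements about plain functions.\<close>

definition int_comb :: "nat \<Rightarrow> (nat \<Rightarrow> 'v \<Rightarrow>\<^sub>0 int) \<Rightarrow> (nat \<Rightarrow> int) \<Rightarrow> 'v \<Rightarrow>\<^sub>0 int" where
  "int_comb n b t = (\<Sum>i<n. frag_cmul (t i) (b i))"

definition zbasis :: "nat \<Rightarrow> (nat \<Rightarrow> 'v \<Rightarrow>\<^sub>0 int) \<Rightarrow> ('v \<Rightarrow>\<^sub>0 int) set \<Rightarrow> bool" where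
  "zbasis n b W \<longleftrightarrow> range (int_comb n b) = W \<and> (\<forall>t. int_comb n b t = 0 \<longrightarrow> (\<forall>i<n. t i = 0))"

lemma frag_cmul_diff_distrib2: "frag_cmul c (a - b) = frag_cmul c a - frag_cmul c b"
  by (simp add: poly_mapping_eqI lookup_minus right_diff_distrib)

lemma frag_cmul_sum_left: "frag_cmul (sum t I) x = (\<Sum>i\<in>I. frag_cmul (t i) x)"
  by (induction I rule: infinite_finite_induct) (auto simp: frag_cmul_distrib)

lemma int_comb_cong:
  "\<lbrakk>\<And>i. i < n \<Longrightarrow> b i = b' i; \<And>i. i < n \<Longrightarrow> t i = t' i\<rbrakk> \<Longrightarrow> int_comb n b t = int_comb n b' t'"
  unfolding int_comb_def by (rule sum.cong) auto

lemma int_comb_add: "int_comb n b (\<lambda>i. s i + t i) = int_comb n b s + int_comb n b t"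
  by (simp add: int_comb_def frag_cmul_distrib sum.distrib)

lemma int_comb_diff: "int_comb n b (\<lambda>i. s i - t i) = int_comb n b s - int_comb n b t"
  by (simp add: int_comb_def frag_cmul_diff_distrib sum_subtractf)

lemma int_comb_cmul: "int_comb n b (\<lambda>i. q * t i) = frag_cmul q (int_comb n b t)"
  by (simp add: int_comb_def frag_cmul_sum)

lemma int_comb_zero [simp]: "int_comb n b (\<lambda>i. 0) = 0"
  by (simp add: int_comb_def)

lemma int_comb_0 [simp]: "int_comb 0 b t = 0"
  by (simp add: int_comb_def)

lemma int_comb_Suc:
  "int_comb (Suc n) b t = frag_cmul (t 0) (b 0) + int_comb n (\<lambda>i. b (Suc i)) (\<lambda>i. t (Suc i))"
  unfolding int_comb_def by (rule sum.lessThan_Suc_shift)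

lemma int_comb_split:
  "int_comb (r + m) b t = int_comb r b t + int_comb m (\<lambda>i. b (r + i)) (\<lambda>i. t (r + i))"
proof (induction m)
  case (Suc m)
  then show ?case by (simp add: int_comb_def add.assoc)
qed simp

lemma int_comb_delta: "j < n \<Longrightarrow> int_comb n b (\<lambda>i. if i = j then q else 0) = frag_cmul q (b j)"
  by (simp add: int_comb_def if_distrib [of "\<lambda>q. frag_cmul q _"] cong: if_cong)

lemma additive_frag_cmul:
  fixes f :: "('v \<Rightarrow>\<^sub>0 int) \<Rightarrow> ('w \<Rightarrow>\<^sub>0 int)"
  assumes "additive f"
  shows "f (frag_cmul q x) = frag_cmul q (f x)"
proof (induction q rule: int_induct [where k = 0])
  case base
  show ?case by (simp add: additive.zero [OF assms])
next
  case (step1 i)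
  then show ?case by (simp add: frag_cmul_distrib additive.add [OF assms])
next
  case (step2 i)
  then show ?case by (simp add: frag_cmul_diff_distrib additive.diff [OF assms])
qed

lemma additive_int_comb:
  "additive f \<Longrightarrow> f (int_comb n b t) = int_comb n (\<lambda>i. f (b i)) t"
  by (simp add: int_comb_def additive.sum additive_frag_cmul)

lemma zbasis_range: "zbasis n b W \<Longrightarrow> range (int_comb n b) = W"
  by (simp add: zbasis_def)

lemma zbasis_mem: "zbasis n b W \<Longrightarrow> int_comb n b t \<in> W"
  by (auto simp: zbasis_def)

lemma zbasis_elem: "\<lbrakk>zbasis n b W; i < n\<rbrakk> \<Longrightarrow> b i \<in> W"
  using zbasis_mem [of n b W "\<lambda>j. if j = i then 1 else 0"] by (simp add: int_comb_delta)

lemma zbasis_obtain: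
  assumes "zbasis n b W" "x \<in> W"
  obtains t where "x = int_comb n b t"
  using assms by (auto simp: zbasis_def)

lemma zbasis_unique:
  assumes "zbasis n b W" "int_comb n b s = int_comb n b t" "i < n"
  shows "s i = t i"
proof -
  have "int_comb n b (\<lambda>i. s i - t i) = 0"
    using assms by (simp add: int_comb_diff)
  then show ?thesis using assms unfolding zbasis_def by fastforce
qed

text \<open>A new family is a basis as soon as its combinations and the old ones can be rewritten into each other;
  the last premise transfers linear independence along the rewriting \<open>P\<close>. The elementary basis
  changes below are the instances that the Smith normal form needs.\<close>

lemma zbasis_change:
  fixes P Q :: "(nat \<Rightarrow> int) \<Rightarrow> nat \<Rightarrow> int"
  assumes "zbasis n b W"
    and "\<And>t. int_comb n b' t = int_comb n b (P t)"
    and "\<And>t. int_comb n b t = int_comb n b' (Q t)"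
    and "\<And>t i. \<forall>i<n. P t i = 0 \<Longrightarrow> i < n \<Longrightarrow> t i = 0"
  shows "zbasis n b' W"
  unfolding zbasis_def
proof (intro conjI allI impI)
  have "range (int_comb n b') \<subseteq> range (int_comb n b)"
    unfolding assms(2) [abs_def] by blast
  moreover have "range (int_comb n b) \<subseteq> range (int_comb n b')"
    unfolding assms(3) [abs_def] by blast
  ultimately show "range (int_comb n b') = W"
    using zbasis_range [OF assms(1)] by blast
next
  fix t i assume "int_comb n b' t = 0" "i < n"
  then have "\<forall>i<n. P t i = 0" using assms(1) unfolding zbasis_def assms(2) by blast
  then show "t i = 0" using assms(4) \<open>i < n\<close> by blast
qed

lemma int_comb_transpose:
  assumes "i < n" "j < n"
  shows "int_comb n (b \<circ> Transposition.transpose i j) (t \<circ> Transposition.transpose i j) = int_comb n b t"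
proof -
  have "bij_betw (Transposition.transpose i j) {..<n} {..<n}"
    using assms by (intro bij_betw_byWitness [where f' = "Transposition.transpose i j"])
      (auto simp: Transposition.transpose_def)
  from sum.reindex_bij_betw [OF this, of "\<lambda>i. frag_cmul (t i) (b i)"]
  show ?thesis by (simp add: int_comb_def)
qed

lemma zbasis_transpose:
  assumes "zbasis n b W" "i < n" "j < n"
  shows "zbasis n (b \<circ> Transposition.transpose i j) W"
proof (rule zbasis_change [OF assms(1)])
  show "int_comb n b t = int_comb n (b \<circ> Transposition.transpose i j) (t \<circ> Transposition.transpose i j)" for t
    by (rule int_comb_transpose [OF assms(2,3), symmetric])
  show "int_comb n (b \<circ> Transposition.transpose i j) t = int_comb n b (t \<circ> Transposition.transpose i j)" for t
    using int_comb_transpose [OF assms(2,3), of b "t \<circ> Transposition.transpose i j"] by (simp add: comp_assoc)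
next
  fix t :: "nat \<Rightarrow> int" and k assume z: "\<forall>l<n. (t \<circ> Transposition.transpose i j) l = 0" and "k < n"
  have "Transposition.transpose i j k < n"
    using assms \<open>k < n\<close> by (auto simp: Transposition.transpose_def)
  then show "t k = 0" using z by fastforce
qed

text \<open>In the target, this absorbs the other coefficients of the image of the pivot element, with the unit \<open>u\<close>
  to correct the sign; in the source, it brings a further row into that of the pivot.\<close>

lemma zbasis_change_first:
  assumes "zbasis (Suc n) b W" and u: "u * u = (1::int)"
  shows "zbasis (Suc n) (case_nat (frag_cmul u (b 0 + int_comb n (\<lambda>i. b (Suc i)) w)) (\<lambda>i. b (Suc i))) W"
proof (rule zbasis_change [OF assms(1)])
  fix t
  let ?b' = "case_nat (frag_cmul u (b 0 + int_comb n (\<lambda>i. b (Suc i)) w)) (\<lambda>i. b (Suc i))"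
  show "int_comb (Suc n) ?b' t = int_comb (Suc n) b (case_nat (t 0 * u) (\<lambda>i. (t 0 * u) * w i + t (Suc i)))"
    by (simp add: int_comb_Suc frag_cmul_distrib2 int_comb_add int_comb_cmul)
  show "int_comb (Suc n) b t = int_comb (Suc n) ?b' (case_nat (t 0 * u) (\<lambda>i. t (Suc i) - t 0 * w i))"
    using u by (simp add: int_comb_Suc frag_cmul_distrib2 int_comb_diff int_comb_cmul mult.assoc)
next
  fix t :: "nat \<Rightarrow> int" and i
  assume z: "\<forall>i<Suc n. case_nat (t 0 * u) (\<lambda>i. (t 0 * u) * w i + t (Suc i)) i = 0" and i: "i < Suc n"
  have "t 0 * u = 0" using z by fastforce
  moreover have "t (Suc i) = 0" if "i < n" for i
    using z [rule_format, of "Suc i"] that \<open>t 0 * u = 0\<close> by simp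
  moreover have "u \<noteq> 0" using u by auto
  ultimately show "t i = 0" using i by (cases i) auto
qed

text \<open>This clears the column of the pivot.\<close>

lemma zbasis_change_rest:
  assumes "zbasis (Suc n) b W"
  shows "zbasis (Suc n) (case_nat (b 0) (\<lambda>i. b (Suc i) - frag_cmul (p i) (b 0))) W"
proof (rule zbasis_change [OF assms(1)])
  let ?b' = "case_nat (b 0) (\<lambda>i. b (Suc i) - frag_cmul (p i) (b 0))"
  have *: "int_comb n (\<lambda>i. b (Suc i) - frag_cmul (p i) (b 0)) t
      = int_comb n (\<lambda>i. b (Suc i)) t - frag_cmul (\<Sum>i<n. t i * p i) (b 0)" for t
    by (simp add: int_comb_def frag_cmul_diff_distrib2 sum_subtractf frag_cmul_sum_left)
  show "int_comb (Suc n) ?b' t = int_comb (Suc n) b (case_nat (t 0 - (\<Sum>i<n. t (Suc i) * p i)) (\<lambda>i. t (Suc i)))" for t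
    by (simp add: int_comb_Suc * frag_cmul_diff_distrib)
  show "int_comb (Suc n) b t = int_comb (Suc n) ?b' (case_nat (t 0 + (\<Sum>i<n. t (Suc i) * p i)) (\<lambda>i. t (Suc i)))" for t
    by (simp add: int_comb_Suc * frag_cmul_distrib)
next
  fix t :: "nat \<Rightarrow> int" and i
  assume z: "\<forall>i<Suc n. case_nat (t 0 - (\<Sum>i<n. t (Suc i) * p i)) (\<lambda>i. t (Suc i)) i = 0" and i: "i < Suc n"
  have S: "t (Suc i) = 0" if "i < n" for i
    using z [rule_format, of "Suc i"] that by simp
  moreover have "t 0 = 0" using z [rule_format, of 0] S by simp
  ultimately show "t i = 0" using i by (cases i) auto
qed

lemma zbasis_tail:
  assumes "zbasis (r + p) b W"
  shows "zbasis p (\<lambda>i. b (r + i)) (range (int_comb p (\<lambda>i. b (r + i))))"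
  unfolding zbasis_def
proof (intro conjI allI impI refl)
  fix t i assume "int_comb p (\<lambda>i. b (r + i)) t = 0" "i < p"
  then have "int_comb (r + p) b (\<lambda>i. if i < r then 0 else t (i - r)) = 0"
    by (simp add: int_comb_split cong: int_comb_cong)
  then have "\<forall>j<r + p. (if j < r then 0 else t (j - r)) = 0"
    using assms unfolding zbasis_def by blast
  with \<open>i < p\<close> show "t i = 0" by (auto dest: spec [of _ "r + i"])
qed

text \<open>The tail of a basis may be exchanged for any basis of its span. This glues partial bases together, both
  in the induction for the Smith normal form and for chain groups.\<close>

lemma zbasis_splice:
  assumes b: "zbasis (r + p) b W"
    and e: "zbasis m e (range (int_comb p (\<lambda>i. b (r + i))))"
  shows "zbasis (r + m) (\<lambda>i. if i < r then b i else e (i - r)) W"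
proof -
  let ?g = "\<lambda>i. if i < r then b i else e (i - r)"
  have g: "int_comb (r + m) ?g t = int_comb r b t + int_comb m e (\<lambda>i. t (r + i))" for t
    by (simp add: int_comb_split cong: int_comb_cong)
  have comb: "int_comb (r + p) b (\<lambda>i. if i < r then t i else u (i - r))
      = int_comb r b t + int_comb p (\<lambda>i. b (r + i)) u" for t u
    by (simp add: int_comb_split cong: int_comb_cong)
  have fwd: "\<exists>u. int_comb (r + m) ?g t = int_comb (r + p) b (\<lambda>i. if i < r then t i else u (i - r)) \<and>
      int_comb m e (\<lambda>i. t (r + i)) = int_comb p (\<lambda>i. b (r + i)) u" for t
    using zbasis_mem [OF e, of "\<lambda>i. t (r + i)"] by (fastforce simp: g comb)
  show ?thesis
    unfolding zbasis_def
  proof (intro conjI allI impI subset_antisym subsetI)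
    fix x assume "x \<in> range (int_comb (r + m) ?g)"
    then show "x \<in> W" using fwd zbasis_range [OF b] by force
  next
    fix x assume "x \<in> W"
    then obtain t where t: "x = int_comb (r + p) b t" using zbasis_obtain [OF b] by blast
    obtain u where u: "int_comb p (\<lambda>i. b (r + i)) (\<lambda>i. t (r + i)) = int_comb m e u"
      using zbasis_range [OF e] by blast
    have "x = int_comb (r + m) ?g (\<lambda>i. if i < r then t i else u (i - r))"
      unfolding g t int_comb_split u by (simp cong: int_comb_cong)
    then show "x \<in> range (int_comb (r + m) ?g)" by blast
  next
    fix t i assume z: "int_comb (r + m) ?g t = 0" and i: "i < r + m"
    obtain u where u: "int_comb (r + p) b (\<lambda>i. if i < r then t i else u (i - r)) = 0"
      "int_comb m e (\<lambda>i. t (r + i)) = int_comb p (\<lambda>i. b (r + i)) u"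
      using fwd [of t] z by auto
    have nul: "(if i < r then t i else u (i - r)) = 0" if "i < r + p" for i
      using b u(1) that unfolding zbasis_def by blast
    have "int_comb p (\<lambda>i. b (r + i)) u = int_comb p (\<lambda>i. b (r + i)) (\<lambda>i. 0)"
    proof (rule int_comb_cong)
      show "u i = 0" if "i < p" for i using nul [of "r + i"] that by simp
    qed simp
    then have "int_comb m e (\<lambda>i. t (r + i)) = 0" using u(2) by simp
    then have "\<forall>i<m. t (r + i) = 0" using e unfolding zbasis_def by blast
    then show "t i = 0"
      using nul [of i] i by (cases "i < r") (auto simp: not_less le_iff_add)
  qed
qed

section \<open>Smith normal form\<close>

text \<open>Among all nonzero matrix entries of \<open>f\<close> with respect to all pairs of bases, take one, \<open>d\<close>, of least
  absolute value. It divides every other entry of its row, since otherwise a basis change would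
  produce a nonzero remainder, which is smaller; so \<open>f\<close> maps the corresponding basis element to \<open>d\<close>
  times an element of a basis. By the same argument, \<open>d\<close> divides its column, so that this element can be
  cleared from the images of the other basis elements. Adding another basis element to the first one brings any remaining entry into the row of \<open>d\<close>, so
  \<open>d\<close> divides these entries, too.\<close>

lemma minimal_pivot:
  assumes f: "additive f" "f ` A \<subseteq> B"
    and b: "zbasis (Suc n) b A" and c: "zbasis (Suc m) c B"
    and nz: "i < Suc n" "f (b i) \<noteq> 0"
  obtains b c and d :: nat where
    "zbasis (Suc n) b A" "zbasis (Suc m) c B" "0 < d" "f (b 0) = frag_cmul (int d) (c 0)"
    "\<And>i. i < n \<Longrightarrow> \<exists>t. f (b (Suc i)) = frag_cmul (int d) (int_comb m (\<lambda>j. c (Suc j)) t)"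
proof -
  \<comment> \<open>the absolute values of the nonzero matrix entries of \<open>f\<close>, over all choices of bases\<close>
  define Entry where "Entry e \<longleftrightarrow> (\<exists>b c i j t. zbasis (Suc n) b A \<and> zbasis (Suc m) c B \<and> i < Suc n \<and>
      j < Suc m \<and> f (b i) = int_comb (Suc m) c t \<and> t j \<noteq> 0 \<and> e = nat \<bar>t j\<bar>)" for e
  have ex: "\<exists>t. f x = int_comb (Suc m) c t" if "zbasis (Suc m) c B" "x \<in> A" for x c
    using zbasis_obtain [OF that(1)] f(2) that(2) by blast
  have "\<exists>e. Entry e"
  proof -
    obtain t where t: "f (b i) = int_comb (Suc m) c t" using ex [OF c] zbasis_elem [OF b] nz by blast
    have "\<exists>j<Suc m. t j \<noteq> 0"
    proof (rule ccontr)
      assume "\<not> ?thesis"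
      then have "int_comb (Suc m) c t = int_comb (Suc m) c (\<lambda>i. 0)" by (intro int_comb_cong) auto
      with t nz show False by simp
    qed
    then show ?thesis using b c nz t unfolding Entry_def by blast
  qed
  define d where "d = (LEAST e. Entry e)"
  have "Entry d" unfolding d_def using \<open>\<exists>e. Entry e\<close> by (rule LeastI_ex)
  then obtain b0 c0 i0 j0 t0 where *: "zbasis (Suc n) b0 A" "zbasis (Suc m) c0 B" "i0 < Suc n" "j0 < Suc m"
      "f (b0 i0) = int_comb (Suc m) c0 t0" "t0 j0 \<noteq> 0" "d = nat \<bar>t0 j0\<bar>"
    unfolding Entry_def by blast
  have "0 < d" using * by simp
  have min: "t j = 0" if "zbasis (Suc n) b A" "zbasis (Suc m) c B" "i < Suc n" "j < Suc m"
      "f (b i) = int_comb (Suc m) c t" "\<bar>t j\<bar> < int d" for b c i j t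
  proof (rule ccontr)
    assume "t j \<noteq> 0"
    then have "Entry (nat \<bar>t j\<bar>)" using that unfolding Entry_def by blast
    then have "d \<le> nat \<bar>t j\<bar>" unfolding d_def by (rule Least_le)
    then show False using that(6) by linarith
  qed
  \<comment> \<open>the basis change in the target turns the entry \<open>t (Suc j)\<close> into its remainder modulo the pivot\<close>
  have row: "t 0 dvd t (Suc j)" if b: "zbasis (Suc n) b A" and c: "zbasis (Suc m) c B"
      and t: "f (b 0) = int_comb (Suc m) c t" "\<bar>t 0\<bar> = int d" and j: "j < m" for b c t j
  proof -
    let ?w = "\<lambda>i. if i = j then t (Suc j) div t 0 else 0"
    let ?c = "case_nat (frag_cmul 1 (c 0 + int_comb m (\<lambda>i. c (Suc i)) ?w)) (\<lambda>i. c (Suc i))"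
    let ?t = "case_nat (t 0) (\<lambda>i. t (Suc i) - t 0 * ?w i)"
    have "zbasis (Suc m) ?c B" by (rule zbasis_change_first [OF c]) simp
    moreover have "f (b 0) = int_comb (Suc m) ?c ?t"
      unfolding t(1) int_comb_Suc
      by (simp add: frag_cmul_distrib2 int_comb_diff flip: int_comb_cmul)
    moreover have "?t (Suc j) = t (Suc j) mod t 0" by (simp add: minus_mult_div_eq_mod)
    moreover have "\<bar>t (Suc j) mod t 0\<bar> < int d"
      using t(2) \<open>0 < d\<close> abs_mod_less [of "t 0" "t (Suc j)"] by simp
    ultimately have "t (Suc j) mod t 0 = 0"
      using min [OF b, of ?c 0 "Suc j" ?t] j by simp
    then show ?thesis by presburger
  qed
  \<comment> \<open>a minimal entry is moved to position 0 in both bases\<close>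
  define b1 where "b1 = b0 \<circ> Transposition.transpose 0 i0"
  define c1 where "c1 = c0 \<circ> Transposition.transpose 0 j0"
  have b1: "zbasis (Suc n) b1 A" and c1: "zbasis (Suc m) c1 B"
    unfolding b1_def c1_def using * by (auto intro!: zbasis_transpose)
  have "int_comb (Suc m) c1 (t0 \<circ> Transposition.transpose 0 j0) = int_comb (Suc m) c0 t0"
    unfolding c1_def using * by (intro int_comb_transpose) auto
  moreover define t1 where "t1 = t0 \<circ> Transposition.transpose 0 j0"
  ultimately have t1: "f (b1 0) = int_comb (Suc m) c1 t1" "\<bar>t1 0\<bar> = int d"
    using * by (auto simp: b1_def)
  define u where "u = sgn (t1 0)"
  have u: "u * u = 1" "t1 0 = int d * u"
    using t1(2) \<open>0 < d\<close> unfolding u_def by (auto simp: sgn_if abs_if split: if_splits)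
  \<comment> \<open>with the quotients as weights, the image of \<open>b1 0\<close> becomes exactly \<open>d\<close> times a basis element\<close>
  define w where "w = (\<lambda>i. t1 (Suc i) div t1 0)"
  define c2 where "c2 = case_nat (frag_cmul u (c1 0 + int_comb m (\<lambda>i. c1 (Suc i)) w)) (\<lambda>i. c1 (Suc i))"
  have c2: "zbasis (Suc m) c2 B" unfolding c2_def by (rule zbasis_change_first [OF c1 u(1)])
  have fb1: "f (b1 0) = frag_cmul (int d) (c2 0)"
  proof -
    have "int_comb m (\<lambda>i. c1 (Suc i)) (\<lambda>i. t1 (Suc i)) = int_comb m (\<lambda>i. c1 (Suc i)) (\<lambda>i. t1 0 * w i)"
      using row [OF b1 c1 t1] by (intro int_comb_cong) (auto simp: w_def)
    then show ?thesis
      unfolding t1(1) int_comb_Suc c2_def by (simp add: u(2) frag_cmul_distrib2 int_comb_cmul)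
  qed
  have "\<forall>i. \<exists>t. i < n \<longrightarrow> f (b1 (Suc i)) = int_comb (Suc m) c2 t"
    using ex [OF c2] zbasis_elem [OF b1] by blast
  from choice [OF this] obtain T where
    T: "\<And>i. i < n \<Longrightarrow> f (b1 (Suc i)) = int_comb (Suc m) c2 (T i)" by blast
  define b2 where "b2 = case_nat (b1 0) (\<lambda>i. b1 (Suc i) - frag_cmul (T i 0 div int d) (b1 0))"
  have b2: "zbasis (Suc n) b2 A" unfolding b2_def by (rule zbasis_change_rest [OF b1])
  have fb2: "f (b2 (Suc i)) = int_comb m (\<lambda>j. c2 (Suc j)) (\<lambda>j. T i (Suc j))" if i: "i < n" for i
  proof -
    have eq: "f (b2 (Suc i)) = int_comb (Suc m) c2 (case_nat (T i 0 mod int d) (\<lambda>j. T i (Suc j)))"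
      unfolding b2_def using T [OF i]
      by (simp add: additive.diff [OF f(1)] additive_frag_cmul [OF f(1)] fb1 int_comb_Suc
          flip: minus_div_mult_eq_mod) (simp add: frag_cmul_diff_distrib)
    \<comment> \<open>a remainder modulo \<open>d\<close> is an entry that is smaller than \<open>d\<close>, hence zero\<close>
    have "case_nat (T i 0 mod int d) (\<lambda>j. T i (Suc j)) 0 = 0"
      using \<open>0 < d\<close> i by (intro min [OF b2 c2 _ _ eq]) auto
    then show ?thesis unfolding eq int_comb_Suc by simp
  qed
  show thesis
  proof
    show "f (b2 0) = frag_cmul (int d) (c2 0)" by (simp add: b2_def fb1)
    fix i assume i: "i < n"
    \<comment> \<open>adding \<open>b2 (Suc i)\<close> to \<open>b2 0\<close> puts the coefficients of its image into the row of the pivot\<close>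
    let ?w = "\<lambda>l. if l = i then 1 else 0"
    let ?b = "case_nat (frag_cmul 1 (b2 0 + int_comb n (\<lambda>i. b2 (Suc i)) ?w)) (\<lambda>i. b2 (Suc i))"
    have "f (?b 0) = int_comb (Suc m) c2 (case_nat (int d) (\<lambda>j. T i (Suc j)))"
      using i by (simp add: int_comb_delta additive.add [OF f(1)] fb2 int_comb_Suc) (simp add: b2_def fb1)
    moreover have "zbasis (Suc n) ?b A" by (rule zbasis_change_first [OF b2]) simp
    ultimately have "int d dvd T i (Suc j)" if "j < m" for j
      using row [OF _ c2, of ?b] that by fastforce
    then have "int_comb m (\<lambda>j. c2 (Suc j)) (\<lambda>j. T i (Suc j))
        = int_comb m (\<lambda>j. c2 (Suc j)) (\<lambda>j. int d * (T i (Suc j) div int d))"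
      by (intro int_comb_cong) auto
    then show "\<exists>t. f (b2 (Suc i)) = frag_cmul (int d) (int_comb m (\<lambda>j. c2 (Suc j)) t)"
      unfolding fb2 [OF i] int_comb_cmul by blast
  qed (use b2 c2 \<open>0 < d\<close> in auto)
qed

text \<open>The pivot splits off, and the induction continues with the spans of the remaining basis elements.
  There \<open>f\<close> takes values in the multiples of \<open>d\<close>, which makes \<open>d\<close> divide the next diagonal entry.\<close>

theorem smith_normal_form:
  assumes "additive f" "zbasis n b A" "zbasis m c B" "f ` A \<subseteq> B"
  shows "\<exists>b c r a. zbasis n b A \<and> zbasis m c B \<and> r \<le> n \<and> r \<le> m \<and>
    (\<forall>i<r. 0 < a i \<and> f (b i) = frag_cmul (int (a i)) (c i)) \<and>
    (\<forall>i. r \<le> i \<and> i < n \<longrightarrow> f (b i) = 0) \<and>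
    (\<forall>i. Suc i < r \<longrightarrow> a i dvd (a (Suc i) :: nat))"
  using assms(2-4)
proof (induction n arbitrary: b A m c B)
  case 0
  then show ?case by (intro exI [of _ b] exI [of _ c] exI [of _ 0]) auto
next
  case (Suc n)
  show ?case
  proof (cases "\<forall>i<Suc n. f (b i) = 0")
    case True
    then show ?thesis using Suc.prems by (intro exI [of _ b] exI [of _ c] exI [of _ 0]) auto
  next
    case False
    then obtain i where i: "i < Suc n" "f (b i) \<noteq> 0" by blast
    obtain k where m: "m = Suc k"
    proof (cases m)
      case 0
      then have "B = {0}" using Suc.prems(2) by (auto simp: zbasis_def)
      then show ?thesis using i zbasis_elem [OF Suc.prems(1)] Suc.prems(3) by blast
    qed
    obtain b' c' d where P: "zbasis (Suc n) b' A" "zbasis (Suc k) c' B" "0 < d"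
      "f (b' 0) = frag_cmul (int d) (c' 0)"
      "\<And>i. i < n \<Longrightarrow> \<exists>t. f (b' (Suc i)) = frag_cmul (int d) (int_comb k (\<lambda>j. c' (Suc j)) t)"
      using minimal_pivot [OF assms(1) Suc.prems(3,1) Suc.prems(2) [unfolded m] i] by metis
    define A1 where "A1 = range (int_comb n (\<lambda>i. b' (Suc i)))"
    define B1 where "B1 = range (int_comb k (\<lambda>i. c' (Suc i)))"
    have A1: "zbasis n (\<lambda>i. b' (Suc i)) A1" and B1: "zbasis k (\<lambda>i. c' (Suc i)) B1"
      unfolding A1_def B1_def using P zbasis_tail [of 1] by fastforce+
    obtain T where T: "\<And>i. i < n \<Longrightarrow> f (b' (Suc i)) = frag_cmul (int d) (int_comb k (\<lambda>j. c' (Suc j)) (T i))"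
      using P(5) by metis
    have fA1: "\<exists>y \<in> B1. f x = frag_cmul (int d) y" if x: "x \<in> A1" for x
    proof -
      obtain t where t: "x = int_comb n (\<lambda>i. b' (Suc i)) t" using x A1_def by blast
      let ?y = "\<Sum>i<n. frag_cmul (t i) (int_comb k (\<lambda>j. c' (Suc j)) (T i))"
      have "?y = int_comb k (\<lambda>j. c' (Suc j)) (\<lambda>j. \<Sum>i<n. t i * T i j)"
        unfolding int_comb_def frag_cmul_sum frag_cmul_sum_left by (subst sum.swap) simp
      then have "?y \<in> B1" unfolding B1_def by blast
      moreover have "f x = frag_cmul (int d) ?y"
        unfolding t additive_int_comb [OF assms(1)] unfolding int_comb_def [of n] frag_cmul_sum
        by (intro sum.cong) (auto simp: T mult.commute)
      ultimately show ?thesis by blast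
    qed
    have cmulB1: "frag_cmul q y \<in> B1" if "y \<in> B1" for q y
      using that unfolding B1_def by (auto simp flip: int_comb_cmul)
    have "f ` A1 \<subseteq> B1"
    proof
      fix y assume "y \<in> f ` A1"
      then obtain x where "x \<in> A1" "y = f x" by blast
      with fA1 cmulB1 show "y \<in> B1" by metis
    qed
    from Suc.IH [OF A1 B1 this] obtain b2 c2 r a where I: "zbasis n b2 A1" "zbasis k c2 B1" "r \<le> n" "r \<le> k"
      "\<And>i. i < r \<Longrightarrow> 0 < a i \<and> f (b2 i) = frag_cmul (int (a i)) (c2 i)"
      "\<And>i. r \<le> i \<Longrightarrow> i < n \<Longrightarrow> f (b2 i) = 0"
      "\<And>i. Suc i < r \<Longrightarrow> a i dvd (a (Suc i) :: nat)"
      by metis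
    have "d dvd a 0" if "0 < r"
    proof -
      have "b2 0 \<in> A1" using I(1,3) that zbasis_elem by (metis order_less_le_trans)
      then obtain y where y: "y \<in> B1" "f (b2 0) = frag_cmul (int d) y" using fA1 by blast
      obtain t where t: "y = int_comb k c2 t" using zbasis_obtain [OF I(2) y(1)] .
      have "int_comb k c2 (\<lambda>i. if i = 0 then int (a 0) else 0) = int_comb k c2 (\<lambda>i. int d * t i)"
        using I(4,5) that y(2) unfolding t by (simp add: int_comb_cmul int_comb_delta)
      from zbasis_unique [OF I(2) this, of 0] that I(4) have "int (a 0) = int d * t 0" by simp
      then show ?thesis by (metis dvd_triv_left int_dvd_int_iff)
    qed
    moreover have "zbasis (Suc n) (case_nat (b' 0) b2) A"
    proof -
      have "zbasis (1 + n) (\<lambda>i. if i < 1 then b' i else b2 (i - 1)) A"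
        using P(1) I(1) unfolding A1_def by (intro zbasis_splice [of 1 n]) auto
      moreover have "(\<lambda>i. if i < 1 then b' i else b2 (i - 1)) = case_nat (b' 0) b2"
        by (auto simp: fun_eq_iff split: nat.split)
      ultimately show ?thesis by simp
    qed
    moreover have "zbasis (Suc k) (case_nat (c' 0) c2) B"
    proof -
      have "zbasis (1 + k) (\<lambda>i. if i < 1 then c' i else c2 (i - 1)) B"
        using P(2) I(2) unfolding B1_def by (intro zbasis_splice [of 1 k]) auto
      moreover have "(\<lambda>i. if i < 1 then c' i else c2 (i - 1)) = case_nat (c' 0) c2"
        by (auto simp: fun_eq_iff split: nat.split)
      ultimately show ?thesis by simp
    qed
    ultimately show ?thesis
      using I(3-7) P(3,4) unfolding m
      by (intro exI [of _ "case_nat (b' 0) b2"] exI [of _ "case_nat (c' 0) c2"] exI [of _ "Suc r"]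
          exI [of _ "case_nat d a"]) (auto split: nat.split)
  qed
qed

text \<open>By linear independence in the target, only the basis elements with a zero image contribute to
  the kernel. Thus kernels between finitely generated free groups are free direct summands.\<close>

lemma zbasis_kernel:
  assumes f: "additive f" and b: "zbasis n b A" and c: "zbasis m c B" and r: "r \<le> n" "r \<le> m"
    and fb: "\<forall>i<r. 0 < a i \<and> f (b i) = frag_cmul (int (a i)) (c i)" "\<forall>i. r \<le> i \<and> i < n \<longrightarrow> f (b i) = 0"
  shows "{x \<in> A. f x = 0} = range (int_comb (n - r) (\<lambda>i. b (r + i)))"
proof -
  obtain p where n: "n = r + p" using r le_Suc_ex by blast
  obtain q where m: "m = r + q" using r le_Suc_ex by blast
  have comb: "int_comb n b t = int_comb r b t + int_comb p (\<lambda>i. b (r + i)) (\<lambda>i. t (r + i))" for t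
    unfolding n by (rule int_comb_split)
  have null: "f (int_comb p (\<lambda>i. b (r + i)) t) = 0" for t
    unfolding additive_int_comb [OF f] using fb(2) n by (simp add: int_comb_def)
  have img: "f (int_comb r b t) = int_comb m c (\<lambda>i. if i < r then t i * int (a i) else 0)" for t
    unfolding additive_int_comb [OF f] m int_comb_split using fb(1) by (simp add: int_comb_def)
  show ?thesis
  proof (intro subset_antisym subsetI)
    fix x assume "x \<in> {x \<in> A. f x = 0}"
    then obtain t where t: "x = int_comb n b t" "f x = 0" using zbasis_obtain [OF b] by blast
    have "int_comb m c (\<lambda>i. if i < r then t i * int (a i) else 0) = 0"
      using t(2) by (simp add: t(1) comb additive.add [OF f] null img)
    then have "\<forall>i<m. (if i < r then t i * int (a i) else 0) = 0"
      using c unfolding zbasis_def by blast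
    then have z: "t i = 0" if "i < r" for i
      using fb(1) that r(2) by (force dest: spec [of _ i])
    have "int_comb r b t = int_comb r b (\<lambda>i. 0)" by (rule int_comb_cong) (auto simp: z)
    then have "x = int_comb (n - r) (\<lambda>i. b (r + i)) (\<lambda>i. t (r + i))"
      unfolding t(1) comb by (simp add: n)
    then show "x \<in> range (int_comb (n - r) (\<lambda>i. b (r + i)))" by blast
  next
    fix x assume "x \<in> range (int_comb (n - r) (\<lambda>i. b (r + i)))"
    then obtain t where t: "x = int_comb p (\<lambda>i. b (r + i)) t" using n by auto
    have "x = int_comb n b (\<lambda>i. if i < r then 0 else t (i - r))"
      by (simp add: comb t cong: int_comb_cong)
    then have "x \<in> A" using zbasis_mem [OF b] by simp
    moreover have "f x = 0" unfolding t by (rule null)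
    ultimately show "x \<in> {x \<in> A. f x = 0}" by simp
  qed
qed

section \<open>Presentations by cyclic groups\<close>

text \<open>\<open>G\<close> is the direct sum of the groups \<open>\<int>/c\<^sub>i\<close> for \<open>i < n\<close>, expressed by an additive surjection
  whose kernel is prescribed. An order \<open>c\<^sub>i = 0\<close> yields a summand \<open>\<int>\<close>, so that a basis of a free
  abelian group is the case of the constant \<open>0\<close>. The domain consists of all integer sequences, which
  avoids carrier conditions; the entries from \<open>n\<close> on lie in the kernel.\<close>

definition presents :: "nat \<Rightarrow> (nat \<Rightarrow> nat) \<Rightarrow> ((nat \<Rightarrow> int) \<Rightarrow> 'g) \<Rightarrow> ('g, 'm) monoid_scheme \<Rightarrow> bool" where
  "presents n c \<pi> G \<longleftrightarrow> range \<pi> = carrier G \<and>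
     (\<forall>s t. \<pi> (\<lambda>i. s i + t i) = \<pi> s \<otimes>\<^bsub>G\<^esub> \<pi> t) \<and>
     (\<forall>t. \<pi> t = \<one>\<^bsub>G\<^esub> \<longleftrightarrow> (\<forall>i<n. int (c i) dvd t i))"

lemma presents_iso:
  assumes "presents n c \<pi> G" "group G" "group H" "h \<in> iso G H"
  shows "presents n c (h \<circ> \<pi>) H"
proof -
  interpret group_hom G H h
    using assms by (auto simp: group_hom_def group_hom_axioms_def iso_def)
  have bij: "h ` carrier G = carrier H" "inj_on h (carrier G)"
    using assms(4) by (auto simp: iso_def bij_betw_def)
  have mem: "\<pi> t \<in> carrier G" for t using assms(1) unfolding presents_def by blast
  have "h (\<pi> t) = \<one>\<^bsub>H\<^esub> \<longleftrightarrow> \<pi> t = \<one>\<^bsub>G\<^esub>" for t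
    using inj_on_eq_iff [OF bij(2) mem [of t] G.one_closed] by simp
  then show ?thesis
    using assms(1) bij mem unfolding presents_def by (auto simp flip: image_image)
qed

lemma presents_eq_iff:
  assumes "presents n c \<pi> G" "group G"
  shows "\<pi> s = \<pi> t \<longleftrightarrow> (\<forall>i<n. int (c i) dvd s i - t i)"
proof -
  interpret group G by fact
  have mem: "\<pi> t \<in> carrier G" for t using assms(1) unfolding presents_def by blast
  have "\<pi> s = \<pi> (\<lambda>i. s i - t i) \<otimes>\<^bsub>G\<^esub> \<pi> t"
    using assms(1) unfolding presents_def by (metis (no_types, lifting) ext diff_add_cancel)
  then have "\<pi> s = \<pi> t \<longleftrightarrow> \<pi> (\<lambda>i. s i - t i) = \<one>\<^bsub>G\<^esub>"
    using mem by (metis r_cancel_one)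
  then show ?thesis using assms(1) unfolding presents_def by simp
qed

text \<open>The coset of \<open>x\<close> modulo the subgroup of \<open>m\<close>-th powers, for commutative \<open>G\<close>.\<close>

definition pow_coset :: "nat \<Rightarrow> ('g, 'm) monoid_scheme \<Rightarrow> 'g \<Rightarrow> 'g set" where
  "pow_coset m G x = (\<lambda>z. x \<otimes>\<^bsub>G\<^esub> z [^]\<^bsub>G\<^esub> m) ` carrier G"

text \<open>Taken modulo \<open>m\<close>-th powers, a summand \<open>\<int>/c\<close> becomes \<open>\<int>/(c\<int> + m\<int>)\<close>, and
  \<open>c\<int> + m\<int>\<close> is generated by the greatest common divisor.\<close>

lemma presents_pow_coset_eq_iff:
  assumes \<pi>: "presents n c \<pi> G" and G: "comm_group G"
  shows "pow_coset m G (\<pi> s) = pow_coset m G (\<pi> t) \<longleftrightarrow> (\<forall>i<n. int (gcd m (c i)) dvd s i - t i)"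
proof -
  interpret comm_group G by fact
  have surj: "range \<pi> = carrier G" and add: "\<pi> (\<lambda>i. s i + t i) = \<pi> s \<otimes>\<^bsub>G\<^esub> \<pi> t" for s t
    using \<pi> unfolding presents_def by blast+
  have mem: "\<pi> t \<in> carrier G" for t using surj by blast
  have zero: "\<pi> (\<lambda>i. 0) = \<one>\<^bsub>G\<^esub>" using \<pi> unfolding presents_def by simp
  have pow: "\<pi> t [^]\<^bsub>G\<^esub> k = \<pi> (\<lambda>i. int k * t i)" for t and k :: nat
  proof (induction k)
    case (Suc k)
    have "\<pi> t [^]\<^bsub>G\<^esub> Suc k = \<pi> (\<lambda>i. int k * t i + t i)" by (simp add: Suc add)
    then show ?case by (simp add: algebra_simps)
  qed (simp add: zero)
  have mem_iff: "\<pi> s \<in> pow_coset m G (\<pi> t) \<longleftrightarrow> (\<forall>i<n. int (gcd m (c i)) dvd s i - t i)" for s t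
  proof -
    have "pow_coset m G (\<pi> t) = range (\<lambda>u. \<pi> (\<lambda>i. t i + int m * u i))"
      unfolding pow_coset_def surj [symmetric] image_image by (simp add: pow add)
    then have "\<pi> s \<in> pow_coset m G (\<pi> t) \<longleftrightarrow> (\<exists>u. \<pi> s = \<pi> (\<lambda>i. t i + int m * u i))"
      by blast
    also have "\<dots> \<longleftrightarrow> (\<exists>u. \<forall>i<n. int (c i) dvd s i - t i - int m * u i)"
      by (simp add: presents_eq_iff [OF \<pi> is_group] diff_diff_eq)
    also have "\<dots> \<longleftrightarrow> (\<forall>i<n. \<exists>v. int (c i) dvd s i - t i - int m * v)"
    proof
      assume "\<forall>i<n. \<exists>v. int (c i) dvd s i - t i - int m * v"
      then have "\<forall>i. \<exists>v. i < n \<longrightarrow> int (c i) dvd s i - t i - int m * v" by blast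
      from choice [OF this] show "\<exists>u. \<forall>i<n. int (c i) dvd s i - t i - int m * u i" by blast
    qed blast
    also have "\<dots> \<longleftrightarrow> (\<forall>i<n. int (gcd m (c i)) dvd s i - t i)"
    proof -
      \<comment> \<open>Bezout: \<open>x\<close> is a multiple of \<open>m\<close> modulo \<open>c\<close> iff \<open>gcd m c\<close> divides it\<close>
      have "(\<exists>v. int c dvd x - int m * v) \<longleftrightarrow> int (gcd m c) dvd x" for c :: nat and x :: int
      proof
        assume "\<exists>v. int c dvd x - int m * v"
        then obtain v where v: "int c dvd x - int m * v" ..
        have "int (gcd m c) dvd int c" "int (gcd m c) dvd int m" by simp_all
        then have "int (gcd m c) dvd (x - int m * v) + int m * v"
          using v by (intro dvd_add) (auto intro: dvd_trans)
        then show "int (gcd m c) dvd x" by simp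
      next
        assume "int (gcd m c) dvd x"
        then obtain q where q: "x = gcd (int m) (int c) * q" by auto
        obtain u v where "u * int m + v * int c = gcd (int m) (int c)" using bezout_int by blast
        then have "x - int m * (u * q) = int c * (v * q)" unfolding q by (metis add_diff_cancel_left' distrib_right mult.assoc mult.commute)
        then show "\<exists>v. int c dvd x - int m * v" by (metis dvd_triv_left)
      qed
      then show ?thesis by blast
    qed
    finally show ?thesis .
  qed
  have self: "\<pi> s \<in> pow_coset m G (\<pi> s)" for s by (simp add: mem_iff)
  show ?thesis
  proof
    assume "pow_coset m G (\<pi> s) = pow_coset m G (\<pi> t)"
    then show "\<forall>i<n. int (gcd m (c i)) dvd s i - t i" using self [of s] mem_iff by simp
  next
    assume st: "\<forall>i<n. int (gcd m (c i)) dvd s i - t i"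
    have "int (gcd m (c i)) dvd u - s i \<longleftrightarrow> int (gcd m (c i)) dvd u - t i" if "i < n" for i u
    proof -
      have "u - t i = (u - s i) + (s i - t i)" by simp
      then show ?thesis using st that by (metis dvd_add_left_iff)
    qed
    then have iff: "\<pi> u \<in> pow_coset m G (\<pi> s) \<longleftrightarrow> \<pi> u \<in> pow_coset m G (\<pi> t)" for u
      unfolding mem_iff by blast
    have sub: "pow_coset m G x \<subseteq> range \<pi>" if "x \<in> carrier G" for x
      using that unfolding pow_coset_def surj by auto
    show "pow_coset m G (\<pi> s) = pow_coset m G (\<pi> t)"
    proof (rule Set.set_eqI)
      fix x
      show "x \<in> pow_coset m G (\<pi> s) \<longleftrightarrow> x \<in> pow_coset m G (\<pi> t)"
      proof (cases "x \<in> range \<pi>")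
        case True
        then obtain u where "x = \<pi> u" by (rule rangeE)
        then show ?thesis by (simp only: iff)
      qed (use sub [OF mem] in blast)
    qed
  qed
qed

text \<open>Each coset has exactly one representative whose coordinates are reduced modulo \<open>gcd m (c i)\<close>.\<close>

lemma presents_card_pow_cosets:
  assumes \<pi>: "presents n c \<pi> G" and G: "comm_group G" and m: "0 < m"
  shows "card (pow_coset m G ` carrier G) = (\<Prod>i<n. gcd m (c i))"
proof -
  let ?T = "\<Pi>\<^sub>E i\<in>{..<n}. {0..<int (gcd m (c i))}"
  have g: "0 < int (gcd m (c i))" for i using m by (simp add: gcd_pos_nat)
  have "bij_betw (\<lambda>t. pow_coset m G (\<pi> t)) ?T (pow_coset m G ` carrier G)"
  proof (rule bij_betw_imageI)
    show "inj_on (\<lambda>t. pow_coset m G (\<pi> t)) ?T"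
    proof (rule inj_onI)
      fix s t assume st: "s \<in> ?T" "t \<in> ?T" "pow_coset m G (\<pi> s) = pow_coset m G (\<pi> t)"
      show "s = t"
      proof (rule PiE_ext [OF st(1,2)])
        fix i assume i: "i \<in> {..<n}"
        have "int (gcd m (c i)) dvd s i - t i"
          using st(3) i unfolding presents_pow_coset_eq_iff [OF \<pi> G] by simp
        moreover have "s i \<in> {0..<int (gcd m (c i))}" "t i \<in> {0..<int (gcd m (c i))}"
          using PiE_mem [OF st(1) i] PiE_mem [OF st(2) i] by simp_all
        ultimately show "s i = t i" by (metis atLeastLessThan_iff mod_eq_dvd_iff mod_pos_pos_trivial)
      qed
    qed
    show "(\<lambda>t. pow_coset m G (\<pi> t)) ` ?T = pow_coset m G ` carrier G"
    proof (intro subset_antisym subsetI)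
      fix X assume "X \<in> pow_coset m G ` carrier G"
      moreover have "carrier G = range \<pi>" using \<pi> unfolding presents_def by simp
      ultimately have "X \<in> range (\<lambda>t. pow_coset m G (\<pi> t))" by (simp add: image_image)
      then obtain t where t: "X = pow_coset m G (\<pi> t)" by (rule rangeE)
      let ?t = "\<lambda>i\<in>{..<n}. t i mod int (gcd m (c i))"
      have "X = pow_coset m G (\<pi> ?t)"
        unfolding t presents_pow_coset_eq_iff [OF \<pi> G] by (simp add: minus_mod_eq_mult_div)
      moreover have "?t \<in> ?T" using g by auto
      ultimately show "X \<in> (\<lambda>t. pow_coset m G (\<pi> t)) ` ?T" by blast
    qed (use \<pi> in \<open>auto simp: presents_def\<close>)
  qed
  then have "card (pow_coset m G ` carrier G) = card ?T" by (simp add: bij_betw_same_card)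
  also have "\<dots> = (\<Prod>i<n. gcd m (c i))" by (simp add: card_PiE)
  finally show ?thesis .
qed

text \<open>Suppose that the chains agree below \<open>k\<close>, and let \<open>m\<close> divide \<open>c k\<close>. Then \<open>m\<close> divides all later \<open>c i\<close>,
  so the later factors of the first product are as large as possible, namely \<open>m\<close>. The products
  being equal, this also holds for the second chain, so \<open>m\<close> divides \<open>c' k\<close>. Hence \<open>c k\<close> and \<open>c' k\<close>
  have the same positive divisors, which determines them, including the case of \<open>0\<close>.\<close>

lemma divisor_chain_determined:
  fixes c c' :: "nat \<Rightarrow> nat"
  assumes c: "\<And>i j. \<lbrakk>i \<le> j; j < n\<rbrakk> \<Longrightarrow> c i dvd c j" and c': "\<And>i j. \<lbrakk>i \<le> j; j < n\<rbrakk> \<Longrightarrow> c' i dvd c' j"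
    and prod: "\<And>m. 0 < m \<Longrightarrow> (\<Prod>i<n. gcd m (c i)) = (\<Prod>i<n. gcd m (c' i))"
  shows "i < n \<Longrightarrow> c i = c' i"
proof (induction i rule: less_induct)
  case (less k)
  have half: "m dvd c' k"
    if e: "\<And>i. i < k \<Longrightarrow> c i = c' i" and c: "\<And>i j. \<lbrakk>i \<le> j; j < n\<rbrakk> \<Longrightarrow> c i dvd c j"
      and prod: "\<And>m. 0 < m \<Longrightarrow> (\<Prod>i<n. gcd m (c i)) = (\<Prod>i<n. gcd m (c' i))"
      and m: "0 < m" "m dvd c k" for c c' :: "nat \<Rightarrow> nat" and m
  proof (rule ccontr)
    assume n: "\<not> m dvd c' k"
    have split: "(\<Prod>i<n. gcd m (f i)) = (\<Prod>i<k. gcd m (f i)) * (\<Prod>i=k..<n. gcd m (f i))" for f :: "nat \<Rightarrow> nat"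
      using prod.atLeastLessThan_concat [of 0 k n "\<lambda>i. gcd m (f i)"] less.prems by (simp add: lessThan_atLeast0)
    have "(\<Prod>i<k. gcd m (c i)) = (\<Prod>i<k. gcd m (c' i))" using e by simp
    moreover have "(\<Prod>i<k. gcd m (c' i)) \<noteq> 0" using m by simp
    ultimately have eq: "(\<Prod>i=k..<n. gcd m (c i)) = (\<Prod>i=k..<n. gcd m (c' i))"
      using prod [OF m(1)] unfolding split by (metis mult_left_cancel)
    have "gcd m (c i) = m" if "i \<in> {k..<n}" for i
      using c [of k i] m(2) that by (metis atLeastLessThan_iff dvd_trans gcd_nat.absorb1)
    then have "(\<Prod>i=k..<n. gcd m (c i)) = (\<Prod>i=k..<n. m)" by simp
    moreover have "(\<Prod>i=k..<n. gcd m (c' i)) < (\<Prod>i=k..<n. m)"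
    proof -
      have "gcd m (c' k) < m" using n m(1) by (metis gcd_dvd1 gcd_dvd2 dvd_imp_le le_neq_implies_less)
      moreover have "(\<Prod>i=Suc k..<n. gcd m (c' i)) \<le> (\<Prod>i=Suc k..<n. m)"
        using m by (intro prod_mono) (auto simp: gcd_le1_nat)
      ultimately have "gcd m (c' k) * (\<Prod>i=Suc k..<n. gcd m (c' i)) < m * (\<Prod>i=Suc k..<n. m)"
        using m by (intro mult_less_le_imp_less) (auto simp: prod_pos)
      then show ?thesis using less.prems by (simp add: prod.atLeast_Suc_lessThan del: prod_constant)
    qed
    ultimately show False using eq by simp
  qed
  have dv: "m dvd c k \<longleftrightarrow> m dvd c' k" if "0 < m" for m
  proof
    have IH: "c i = c' i" if "i < k" for i using less that by simp
    show "m dvd c' k" if "m dvd c k" by (rule half [OF IH c prod \<open>0 < m\<close> that])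
    show "m dvd c k" if "m dvd c' k" by (rule half [OF IH [symmetric] c' prod [symmetric] \<open>0 < m\<close> that])
  qed
  show "c k = c' k"
  proof (cases "c k = 0 \<or> c' k = 0")
    case True
    \<comment> \<open>a number that exceeds both entries divides only a zero entry\<close>
    have "Suc (c k + c' k) dvd c k \<longleftrightarrow> Suc (c k + c' k) dvd c' k" by (rule dv) simp
    with True show ?thesis by (auto dest: dvd_imp_le)
  next
    case False
    then show ?thesis using dv [of "c k"] dv [of "c' k"] by (auto intro: dvd_antisym)
  qed
qed

text \<open>Summands \<open>\<int>/1\<close> are trivial. Putting them in front keeps the orders a divisor chain, and makes two
  chains of different lengths comparable.\<close>

lemma presents_pad:
  assumes "presents n c \<pi> G"
  shows "presents (p + n) (\<lambda>i. if i < p then 1 else c (i - p)) (\<lambda>t. \<pi> (\<lambda>i. t (p + i))) G"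
  unfolding presents_def
proof (intro conjI allI)
  have "\<pi> t \<in> range (\<lambda>t. \<pi> (\<lambda>i. t (p + i)))" for t
    by (rule range_eqI [of _ _ "\<lambda>i. t (i - p)"]) simp
  then have "range (\<lambda>t. \<pi> (\<lambda>i. t (p + i))) = range \<pi>" by blast
  then show "range (\<lambda>t. \<pi> (\<lambda>i. t (p + i))) = carrier G" using assms unfolding presents_def by simp
next
  fix t
  have "\<pi> (\<lambda>i. t (p + i)) = \<one>\<^bsub>G\<^esub> \<longleftrightarrow> (\<forall>i<n. int (c i) dvd t (p + i))"
    using assms unfolding presents_def by simp
  also have "\<dots> \<longleftrightarrow> (\<forall>i<p + n. int (if i < p then 1 else c (i - p)) dvd t i)"
  proof (intro iffI allI impI)
    fix i assume "\<forall>i<n. int (c i) dvd t (p + i)" "i < p + n"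
    then show "int (if i < p then 1 else c (i - p)) dvd t i" by (auto dest: spec [of _ "i - p"])
  next
    fix i assume "\<forall>i<p + n. int (if i < p then 1 else c (i - p)) dvd t i" "i < n"
    then show "int (c i) dvd t (p + i)" by (auto dest: spec [of _ "p + i"])
  qed
  finally show "\<pi> (\<lambda>i. t (p + i)) = \<one>\<^bsub>G\<^esub> \<longleftrightarrow> \<dots>" .
qed (use assms in \<open>simp add: presents_def\<close>)

text \<open>The uniqueness of invariant factors. Only the second chain is required to be free of ones, so the
  first one may begin with any number \<open>p\<close> of them.\<close>

theorem presents_unique:
  fixes c c' :: "nat \<Rightarrow> nat"
  assumes G: "comm_group G" and \<pi>: "presents n c \<pi> G" and \<pi>': "presents n' c' \<pi>' G"
    and c: "\<And>i j. \<lbrakk>i \<le> j; j < n\<rbrakk> \<Longrightarrow> c i dvd c j" and c': "\<And>i j. \<lbrakk>i \<le> j; j < n'\<rbrakk> \<Longrightarrow> c' i dvd c' j"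
    and c'1: "\<And>i. i < n' \<Longrightarrow> c' i \<noteq> 1"
  obtains p where "n = p + n'" "\<And>i. i < p \<Longrightarrow> c i = 1" "\<And>i. i < n' \<Longrightarrow> c (p + i) = c' i"
proof -
  define p p' where "p = n - n'" and "p' = n' - n"
  have N: "p + n' = p' + n" unfolding p_def p'_def by simp
  let ?c = "\<lambda>i. if i < p' then 1 else c (i - p')" and ?c' = "\<lambda>i. if i < p then 1 else c' (i - p)"
  have eq: "?c i = ?c' i" if "i < p + n'" for i
  proof (rule divisor_chain_determined [OF _ _ _ that])
    fix i j assume "i \<le> j" "j < p + n'"
    then show "?c i dvd ?c j" "?c' i dvd ?c' j" using c [of "i - p'" "j - p'"] c' [of "i - p" "j - p"] N by auto
  next
    fix m :: nat assume m: "0 < m"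
    show "(\<Prod>i<p + n'. gcd m (?c i)) = (\<Prod>i<p + n'. gcd m (?c' i))"
      using presents_card_pow_cosets [OF presents_pad [OF \<pi>, of p'] G m]
        presents_card_pow_cosets [OF presents_pad [OF \<pi>', of p] G m] unfolding N by simp
  qed
  have "n' \<le> n"
  proof (rule ccontr)
    assume "\<not> n' \<le> n"
    then show False using eq [of 0] c'1 [of 0] by (simp add: p_def p'_def)
  qed
  then have "p' = 0" "n = p + n'" by (auto simp: p'_def p_def)
  then show thesis using eq by (intro that [of p]) force+
qed

lemma presents_FactGroup:
  assumes G: "comm_group G" and N: "subgroup N G" and \<tau>: "range \<tau> = carrier G"
    and add: "\<And>s t. \<tau> (\<lambda>i. s i + t i) = \<tau> s \<otimes>\<^bsub>G\<^esub> \<tau> t"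
    and mem: "\<And>t. \<tau> t \<in> N \<longleftrightarrow> (\<forall>i<n. int (c i) dvd t i)"
  shows "presents n c (\<lambda>t. N #>\<^bsub>G\<^esub> \<tau> t) (G Mod N)"
proof -
  interpret comm_group G by fact
  interpret N: normal N G using N by (rule subgroup_imp_normal)
  have \<tau>_mem: "\<tau> t \<in> carrier G" for t using \<tau> by blast
  have "N #>\<^bsub>G\<^esub> x = N \<longleftrightarrow> x \<in> N" if "x \<in> carrier G" for x
    using that N coset_join1 coset_join2 N.subset by metis
  then show ?thesis
    unfolding presents_def using \<tau>_mem N.r_coset_hom_Mod
    by (auto simp: carrier_FactGroup \<tau> [symmetric] image_image add mem hom_def)
qed

text \<open>The torsion orders come first and the zeros of the free part last, so that the orders form a
  divisor chain.\<close>

lemma presents_sum_of_cyclic: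
  fixes d :: "nat \<Rightarrow> nat" and s \<beta> :: nat
  assumes d: "\<And>i. i \<in> {1..s} \<Longrightarrow> 0 < d i"
  shows "presents (s + \<beta>) (\<lambda>i. if i < s then d (i + 1) else 0)
     (\<lambda>t. (\<lambda>i\<in>{1..\<beta>}. t (s + i - 1), \<lambda>i\<in>{1..s}. t (i - 1) mod int (d i)))
     (sum_group {1..\<beta>} (\<lambda>_. integer_group) \<times>\<times> sum_group {1..s} (\<lambda>i. integer_mod_group (d i)))"
    (is "presents _ _ ?\<pi> (?A \<times>\<times> ?B)")
  unfolding presents_def
proof (intro conjI allI)
  have A: "carrier ?A = {1..\<beta>} \<rightarrow>\<^sub>E UNIV" by (simp add: carrier_sum_group)
  have B: "carrier ?B = (\<Pi>\<^sub>E i\<in>{1..s}. {0..<int (d i)})"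
    using d by (auto simp: carrier_sum_group carrier_integer_mod_group PiE_iff extensional_def)
  show "range ?\<pi> = carrier (?A \<times>\<times> ?B)"
  proof (intro subset_antisym subsetI)
    fix x assume "x \<in> range ?\<pi>"
    then show "x \<in> carrier (?A \<times>\<times> ?B)" unfolding carrier_DirProd A B using d by auto
  next
    fix x assume "x \<in> carrier (?A \<times>\<times> ?B)"
    then obtain u v where x: "x = (u, v)" "u \<in> {1..\<beta>} \<rightarrow>\<^sub>E UNIV" "v \<in> (\<Pi>\<^sub>E i\<in>{1..s}. {0..<int (d i)})"
      unfolding carrier_DirProd A B by auto
    let ?t = "\<lambda>i. if i < s then v (i + 1) else u (i + 1 - s)"
    have "u = (\<lambda>i\<in>{1..\<beta>}. ?t (s + i - 1))"
      by (rule extensionalityI [of _ "{1..\<beta>}"]) (use x in \<open>auto simp: PiE_iff\<close>)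
    moreover have "v = (\<lambda>i\<in>{1..s}. ?t (i - 1) mod int (d i))"
      by (rule extensionalityI [of _ "{1..s}"]) (use x in \<open>auto simp: PiE_iff\<close>)
    ultimately have "x = ?\<pi> ?t" unfolding x(1) by (simp only:)
    then show "x \<in> range ?\<pi>" by (rule range_eqI [where x = ?t])
  qed
next
  fix t t'
  show "?\<pi> (\<lambda>i. t i + t' i) = ?\<pi> t \<otimes>\<^bsub>?A \<times>\<times> ?B\<^esub> ?\<pi> t'"
    by (auto simp: mult_DirProd mod_add_eq restrict_def)
next
  fix t
  have "?\<pi> t = \<one>\<^bsub>?A \<times>\<times> ?B\<^esub> \<longleftrightarrow> (\<forall>i\<in>{1..\<beta>}. t (s + i - 1) = 0) \<and> (\<forall>i\<in>{1..s}. int (d i) dvd t (i - 1))"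
    by (auto simp: one_DirProd restrict_def fun_eq_iff dvd_eq_mod_eq_0)
  also have "\<dots> \<longleftrightarrow> (\<forall>i<s + \<beta>. int (if i < s then d (i + 1) else 0) dvd t i)"
  proof (intro iffI conjI allI ballI impI)
    fix i assume *: "(\<forall>i\<in>{1..\<beta>}. t (s + i - 1) = 0) \<and> (\<forall>i\<in>{1..s}. int (d i) dvd t (i - 1))"
      and i: "i < s + \<beta>"
    show "int (if i < s then d (i + 1) else 0) dvd t i"
    proof (cases "i < s")
      case True
      then show ?thesis using * [THEN conjunct2, rule_format, of "i + 1"] by simp
    next
      case False
      then have "i + 1 - s \<in> {1..\<beta>}" "s + (i + 1 - s) - 1 = i" using i by auto
      then show ?thesis using * False by fastforce
    qed
  next
    fix i assume *: "\<forall>i<s + \<beta>. int (if i < s then d (i + 1) else 0) dvd t i"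
    show "t (s + i - 1) = 0" if "i \<in> {1..\<beta>}"
    proof -
      have "s + i - 1 < s + \<beta>" "\<not> s + i - 1 < s" using that by auto
      then show ?thesis using * [rule_format, of "s + i - 1"] by simp
    qed
    show "int (d i) dvd t (i - 1)" if "i \<in> {1..s}"
    proof -
      have "i - 1 < s" "i - 1 + 1 = i" using that by auto
      then show ?thesis using * [rule_format, of "i - 1"] by (simp del: One_nat_def)
    qed
  qed
  finally show "?\<pi> t = \<one>\<^bsub>?A \<times>\<times> ?B\<^esub> \<longleftrightarrow> \<dots>" .
qed

lemma dvd_chain:
  fixes c :: "nat \<Rightarrow> nat"
  assumes "\<And>i. Suc i < n \<Longrightarrow> c i dvd c (Suc i)" "i \<le> j" "j < n"
  shows "c i dvd c j"
  using assms(2,3) by (induction j rule: dec_induct) (auto intro: dvd_trans [OF _ assms(1)])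

section \<open>Smith bases of a chain complex\<close>

text \<open>\<open>E k\<close> gives the elements of degree \<open>k\<close> in terms of their coordinates. The first \<open>\<rho> k\<close> basis elements
  span a complement of the cycles, and the last \<open>\<mu> k\<close> ones are a basis of the cycles. The
  differential sends the \<open>i\<close>-th element of the complement to \<open>a k i\<close> times the \<open>i\<close>-th cycle of degree
  \<open>k - 1\<close>, which has index \<open>\<rho> (k - 1) + i\<close> there.\<close>

locale smith_form =
  fixes C :: "'a chain_cx" and E :: "int \<Rightarrow> (nat \<Rightarrow> int) \<Rightarrow> 'a" and \<rho> \<mu> :: "int \<Rightarrow> nat"
    and a :: "int \<Rightarrow> nat \<Rightarrow> nat"
  assumes complex: "chain_complex C"
    and presents_E: "\<And>k. presents (\<rho> k + \<mu> k) (\<lambda>_. 0) (E k) (grp C k)"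
    and \<rho>_le_\<mu>: "\<And>k. \<rho> k \<le> \<mu> (k - 1)"
    and a_pos: "\<And>k i. i < \<rho> k \<Longrightarrow> 0 < a k i"
    and a_dvd_Suc: "\<And>k i. Suc i < \<rho> k \<Longrightarrow> a k i dvd a k (Suc i)"
    and bd_E: "\<And>k t. bd C k (E k t) = E (k - 1) (\<lambda>i. if \<rho> (k - 1) \<le> i \<and> i < \<rho> (k - 1) + \<rho> k
        then int (a k (i - \<rho> (k - 1))) * t (i - \<rho> (k - 1)) else 0)"
begin

lemma comm_group_grp: "comm_group (grp C k)"
  using complex by (simp add: chain_complex_def)

lemma group_grp: "group (grp C k)"
  using comm_group_grp by (simp add: comm_group_def)

lemma bd_hom: "bd C k \<in> hom (grp C k) (grp C (k - 1))"
  using complex by (simp add: chain_complex_def)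

lemma carrier_grp: "carrier (grp C k) = range (E k)"
  using presents_E unfolding presents_def by simp

lemma E_mem: "E k t \<in> carrier (grp C k)"
  by (simp add: carrier_grp)

lemma E_add: "E k (\<lambda>i. s i + t i) = E k s \<otimes>\<^bsub>grp C k\<^esub> E k t"
  using presents_E unfolding presents_def by simp

lemma E_eq_iff: "E k s = E k t \<longleftrightarrow> (\<forall>i<\<rho> k + \<mu> k. s i = t i)"
  by (simp add: presents_eq_iff [OF presents_E group_grp])

lemma E_eq_one_iff: "E k t = \<one>\<^bsub>grp C k\<^esub> \<longleftrightarrow> (\<forall>i<\<rho> k + \<mu> k. t i = 0)"
  using presents_E unfolding presents_def by simp

end

text \<open>A basis of \<open>V k\<close> is glued from two Smith normal forms: that of \<open>D k\<close>, which supplies the complement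
  of the cycles, and that of \<open>D (k + 1)\<close> as a map into the cycles, which supplies their basis.\<close>

theorem complex_normal_form:
  fixes D :: "int \<Rightarrow> ('v \<Rightarrow>\<^sub>0 int) \<Rightarrow> ('v \<Rightarrow>\<^sub>0 int)"
  assumes add: "\<And>k. additive (D k)" and V: "\<And>k. zbasis (N k) (B k) (V k)"
    and D: "\<And>k. D k ` V k \<subseteq> V (k - 1)" and DD: "\<And>k x. x \<in> V k \<Longrightarrow> D (k - 1) (D k x) = 0"
  shows "\<exists>g \<rho> \<mu> a. \<forall>k. zbasis (\<rho> k + \<mu> k) (g k) (V k) \<and> \<rho> k \<le> \<mu> (k - 1) \<and>
    (\<forall>i<\<rho> k. 0 < a k i \<and> D k (g k i) = frag_cmul (int (a k i)) (g (k - 1) (\<rho> (k - 1) + i))) \<and>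
    (\<forall>i<\<mu> k. D k (g k (\<rho> k + i)) = 0) \<and>
    (\<forall>i. Suc i < \<rho> k \<longrightarrow> a k i dvd (a k (Suc i) :: nat))"
proof -
  define Z where "Z k = {x \<in> V k. D k x = 0}" for k
  \<comment> \<open>a first use of the Smith normal form, only to see that the cycles have a basis at all\<close>
  have "\<exists>p z. zbasis p z (Z k)" for k
  proof -
    obtain b c r a where *: "zbasis (N k) b (V k)" "zbasis (N (k - 1)) c (V (k - 1))" "r \<le> N k" "r \<le> N (k - 1)"
      "\<forall>i<r. 0 < a i \<and> D k (b i) = frag_cmul (int (a i)) (c i)"
      "\<forall>i. r \<le> i \<and> i < N k \<longrightarrow> D k (b i) = 0"
      using smith_normal_form [OF add V V D] by metis
    from zbasis_kernel [OF add this] zbasis_tail [of r "N k - r" b "V k"] *(1,3)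
    show ?thesis unfolding Z_def by auto
  qed
  then obtain M z where z: "\<And>k. zbasis (M k) (z k) (Z k)" by metis
  have DZ: "D k ` V k \<subseteq> Z (k - 1)" for k using D DD unfolding Z_def by blast
  have "\<forall>k. \<exists>b c r a. zbasis (N k) b (V k) \<and> zbasis (M (k - 1)) c (Z (k - 1)) \<and> r \<le> N k \<and> r \<le> M (k - 1) \<and>
    (\<forall>i<r. 0 < a i \<and> D k (b i) = frag_cmul (int (a i)) (c i)) \<and>
    (\<forall>i. r \<le> i \<and> i < N k \<longrightarrow> D k (b i) = 0) \<and>
    (\<forall>i. Suc i < r \<longrightarrow> a i dvd (a (Suc i) :: nat))"
    using smith_normal_form [OF add V z DZ] by blast
  then obtain b c r a where S: "\<And>k. zbasis (N k) (b k) (V k)" "\<And>k. zbasis (M (k - 1)) (c k) (Z (k - 1))"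
    "\<And>k. r k \<le> N k" "\<And>k. r k \<le> M (k - 1)"
    "\<And>k. \<forall>i<r k. 0 < a k i \<and> D k (b k i) = frag_cmul (int (a k i)) (c k i)"
    "\<And>k. \<forall>i. r k \<le> i \<and> i < N k \<longrightarrow> D k (b k i) = 0"
    "\<And>k. \<forall>i. Suc i < r k \<longrightarrow> a k i dvd (a k (Suc i) :: nat)"
    by metis
  have c: "zbasis (M k) (c (k + 1)) (Z k)" for k using S(2) [of "k + 1"] by simp
  have ker: "Z k = range (int_comb (N k - r k) (\<lambda>i. b k (r k + i)))" for k
    unfolding Z_def by (rule zbasis_kernel [OF add S(1,2,3,4,5,6)])
  define g where "g k = (\<lambda>i. if i < r k then b k i else c (k + 1) (i - r k))" for k
  have "zbasis (r k + M k) (g k) (V k)" for k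
    unfolding g_def using S(1,3) [of k] c [of k] ker [of k]
    by (intro zbasis_splice [of "r k" "N k - r k"]) auto
  moreover have "D k (g k (r k + i)) = 0" if "i < M k" for k i
    using zbasis_elem [OF c that] by (auto simp: g_def Z_def)
  ultimately show ?thesis
    using S(4,5,7) by (intro exI [of _ g] exI [of _ r] exI [of _ M] exI [of _ a]) (simp add: g_def)
qed

lemma lookup_int_comb_frag_of:
  "poly_mapping.lookup (int_comb n frag_of t) i = (if i < n then t i else 0)"
  by (induction n) (auto simp: int_comb_def lookup_add lookup_single when_def less_Suc_eq)

lemma zbasis_frag_of: "zbasis n frag_of (carrier (free_Abelian_group {..<n}))"
  unfolding zbasis_def
proof (intro conjI allI impI subset_antisym subsetI)
  fix x :: "nat \<Rightarrow>\<^sub>0 int" assume "x \<in> range (int_comb n frag_of)"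
  then show "x \<in> carrier (free_Abelian_group {..<n})"
    by (auto simp: in_keys_iff lookup_int_comb_frag_of split: if_splits)
next
  fix x :: "nat \<Rightarrow>\<^sub>0 int" assume "x \<in> carrier (free_Abelian_group {..<n})"
  then have "x = int_comb n frag_of (poly_mapping.lookup x)"
    by (intro poly_mapping_eqI) (auto simp: lookup_int_comb_frag_of in_keys_iff)
  then show "x \<in> range (int_comb n frag_of)" by blast
next
  fix t i assume "int_comb n frag_of t = 0" "i < n"
  then show "t i = 0" using lookup_int_comb_frag_of [of n t i] by simp
qed

text \<open>The chain groups are transported to subgroups of one type of formal integer combinations, where the
  differentials extend to additive maps of the whole type. The resulting bases are carried back.\<close>

theorem smith_form_exists:
  assumes C: "chain_complex C" and free: "\<And>k. fg_free_abelian (grp C k)"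
  shows "\<exists>E \<rho> \<mu> a. smith_form C E \<rho> \<mu> a"
proof -
  have "\<forall>k. \<exists>n \<phi>. \<phi> \<in> iso (grp C k) (free_Abelian_group {..<n::nat})"
    using free unfolding fg_free_abelian_def is_iso_def by blast
  then obtain n \<phi> where \<phi>: "\<And>k. \<phi> k \<in> iso (grp C k) (free_Abelian_group {..<n k :: nat})"
    by metis
  define F where "F k = free_Abelian_group {..<n k}" for k
  define \<psi> where "\<psi> k = inv_into (carrier (grp C k)) (\<phi> k)" for k
  have grp: "comm_group (grp C k)" and bd: "bd C k \<in> hom (grp C k) (grp C (k - 1))"
    and bd2: "x \<in> carrier (grp C k) \<Longrightarrow> bd C (k - 1) (bd C k x) = \<one>\<^bsub>grp C (k - 2)\<^esub>" for k x
    using C unfolding chain_complex_def by auto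
  have grp': "group (grp C k)" for k using grp by (simp add: comm_group_def)
  have \<phi>F: "\<phi> k \<in> iso (grp C k) (F k)" for k unfolding F_def by (rule \<phi>)
  have \<psi>: "\<psi> k \<in> iso (F k) (grp C k)" for k
    unfolding \<psi>_def by (rule group.iso_set_sym [OF grp' \<phi>F])
  have bij: "bij_betw (\<phi> k) (carrier (grp C k)) (carrier (F k))" for k using \<phi>F by (simp add: iso_def)
  have \<phi>\<psi>: "\<phi> k (\<psi> k x) = x" if "x \<in> carrier (F k)" for k x
    using bij_betw_inv_into_right [OF bij that] by (simp add: \<psi>_def)
  have \<psi>\<phi>: "\<psi> k (\<phi> k x) = x" if "x \<in> carrier (grp C k)" for k x
    using bij_betw_inv_into_left [OF bij that] by (simp add: \<psi>_def)
  have \<psi>_mem: "\<psi> k x \<in> carrier (grp C k)" if "x \<in> carrier (F k)" for k x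
    using \<psi> [of k] that by (auto simp: iso_def hom_def)
  have \<phi>_mem: "\<phi> k x \<in> carrier (F k)" if "x \<in> carrier (grp C k)" for k x
    using \<phi>F [of k] that by (auto simp: iso_def hom_def)
  have bd_mem: "bd C k x \<in> carrier (grp C (k - 1))" if "x \<in> carrier (grp C k)" for k x
    using bd [of k] that by (auto simp: hom_def)
  have hom: "\<phi> (k - 1) \<circ> bd C k \<circ> \<psi> k \<in> hom (F k) (F (k - 1))" for k
    using \<psi> \<phi>F bd unfolding iso_def by (blast intro: hom_compose)
  define D where "D k = frag_extend (\<lambda>i. \<phi> (k - 1) (bd C k (\<psi> k (frag_of i))))" for k
  have D: "D k x = \<phi> (k - 1) (bd C k (\<psi> k x))" if "x \<in> carrier (F k)" for k x
  proof -
    have "Poly_Mapping.keys x \<subseteq> {..<n k}" using that by (simp add: F_def)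
    then show ?thesis
    proof (induction x rule: free_Abelian_group_induct [consumes 1, case_names zero diff frag_of])
      case zero
      have "\<phi> (k - 1) (bd C k (\<psi> k (\<one>\<^bsub>F k\<^esub>))) = \<one>\<^bsub>F (k - 1)\<^esub>"
        using hom_one [OF hom [of k]] by (simp add: F_def)
      then show ?case by (simp add: D_def F_def)
    next
      case (diff x y)
      then show ?case
        using hom_frag_diff [OF hom [of k, unfolded F_def], of x y] by (simp add: D_def frag_extend_diff)
    next
      case (frag_of i)
      then show ?case by (simp add: D_def)
    qed
  qed
  have "\<exists>g \<rho> \<mu> a. \<forall>k. zbasis (\<rho> k + \<mu> k) (g k) (carrier (F k)) \<and> \<rho> k \<le> \<mu> (k - 1) \<and>
    (\<forall>i<\<rho> k. 0 < a k i \<and> D k (g k i) = frag_cmul (int (a k i)) (g (k - 1) (\<rho> (k - 1) + i))) \<and>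
    (\<forall>i<\<mu> k. D k (g k (\<rho> k + i)) = 0) \<and>
    (\<forall>i. Suc i < \<rho> k \<longrightarrow> a k i dvd (a k (Suc i) :: nat))"
  proof (rule complex_normal_form)
    show "additive (D k)" for k unfolding D_def by unfold_locales (rule frag_extend_add)
    show "zbasis (n k) frag_of (carrier (F k))" for k unfolding F_def by (rule zbasis_frag_of)
    show "D k ` carrier (F k) \<subseteq> carrier (F (k - 1))" for k
      using D \<phi>_mem \<psi>_mem bd_mem by auto
    show "D (k - 1) (D k x) = 0" if "x \<in> carrier (F k)" for k x
    proof -
      have "D (k - 1) (D k x) = \<phi> (k - 2) (\<one>\<^bsub>grp C (k - 2)\<^esub>)"
        using that by (simp add: D \<phi>_mem \<psi>_mem bd_mem \<psi>\<phi> bd2)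
      also have "\<dots> = \<one>\<^bsub>F (k - 2)\<^esub>"
        using \<phi>F by (intro hom_one) (auto simp: iso_def grp' F_def)
      finally show ?thesis by (simp add: F_def)
    qed
  qed
  then obtain g \<rho> \<mu> a where g: "\<And>k. zbasis (\<rho> k + \<mu> k) (g k) (carrier (F k))" "\<And>k. \<rho> k \<le> \<mu> (k - 1)"
    "\<And>k i. i < \<rho> k \<Longrightarrow> 0 < a k i"
    "\<And>k i. i < \<rho> k \<Longrightarrow> D k (g k i) = frag_cmul (int (a k i)) (g (k - 1) (\<rho> (k - 1) + i))"
    "\<And>k i. i < \<mu> k \<Longrightarrow> D k (g k (\<rho> k + i)) = 0"
    "\<And>k i. Suc i < \<rho> k \<Longrightarrow> a k i dvd (a k (Suc i) :: nat)"
    by metis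
  have "smith_form C (\<lambda>k. \<psi> k \<circ> int_comb (\<rho> k + \<mu> k) (g k)) \<rho> \<mu> a"
  proof (rule smith_form.intro [OF C])
    fix k t
    have "presents (\<rho> k + \<mu> k) (\<lambda>_. 0) (int_comb (\<rho> k + \<mu> k) (g k)) (F k)"
      using g(1) [of k] unfolding presents_def zbasis_def by (auto simp: F_def int_comb_add int_comb_def)
    then show "presents (\<rho> k + \<mu> k) (\<lambda>_. 0) (\<psi> k \<circ> int_comb (\<rho> k + \<mu> k) (g k)) (grp C k)"
      by (rule presents_iso [OF _ _ grp' \<psi>]) (simp add: F_def)
    let ?t = "\<lambda>i. if \<rho> (k - 1) \<le> i \<and> i < \<rho> (k - 1) + \<rho> k
        then int (a k (i - \<rho> (k - 1))) * t (i - \<rho> (k - 1)) else 0"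
    have Dk: "additive (D k)" unfolding D_def by unfold_locales (rule frag_extend_add)
    obtain q where q: "\<mu> (k - 1) = \<rho> k + q" using g(2) le_Suc_ex by blast
    have "D k (int_comb (\<rho> k + \<mu> k) (g k) t) = int_comb (\<rho> k) (\<lambda>i. D k (g k i)) t"
      by (simp add: int_comb_split additive.add [OF Dk] additive_int_comb [OF Dk]) (simp add: int_comb_def g(5))
    also have "\<dots> = int_comb (\<rho> (k - 1) + \<mu> (k - 1)) (g (k - 1)) ?t"
      by (simp add: int_comb_split q) (simp add: int_comb_def g(4) mult.commute)
    finally have "\<phi> (k - 1) (bd C k (\<psi> k (int_comb (\<rho> k + \<mu> k) (g k) t)))
        = int_comb (\<rho> (k - 1) + \<mu> (k - 1)) (g (k - 1)) ?t"
      using zbasis_mem [OF g(1)] by (simp add: D)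
    then show "bd C k ((\<psi> k \<circ> int_comb (\<rho> k + \<mu> k) (g k)) t)
        = (\<psi> (k - 1) \<circ> int_comb (\<rho> (k - 1) + \<mu> (k - 1)) (g (k - 1))) ?t"
      using \<psi>\<phi> [OF bd_mem [OF \<psi>_mem [OF zbasis_mem [OF g(1)]]]] by (metis comp_apply)
  qed (use g in auto)
  then show ?thesis by blast
qed

section \<open>Homology in a Smith basis\<close>

context smith_form begin

lemma E_mem_cycles_iff: "E k t \<in> cycles C k \<longleftrightarrow> (\<forall>i<\<rho> k. t i = 0)"
proof -
  have "E k t \<in> cycles C k \<longleftrightarrow> (\<forall>i<\<rho> (k - 1) + \<mu> (k - 1). \<rho> (k - 1) \<le> i \<and> i < \<rho> (k - 1) + \<rho> k \<longrightarrow>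
      int (a k (i - \<rho> (k - 1))) * t (i - \<rho> (k - 1)) = 0)"
    by (auto simp: cycles_def kernel_def E_mem bd_E E_eq_one_iff)
  also have "\<dots> \<longleftrightarrow> (\<forall>i<\<rho> k. t i = 0)"
  proof (intro iffI allI impI)
    fix i assume z: "\<forall>i<\<rho> (k - 1) + \<mu> (k - 1). \<rho> (k - 1) \<le> i \<and> i < \<rho> (k - 1) + \<rho> k \<longrightarrow>
      int (a k (i - \<rho> (k - 1))) * t (i - \<rho> (k - 1)) = 0" and i: "i < \<rho> k"
    show "t i = 0"
      using z [rule_format, of "\<rho> (k - 1) + i"] i a_pos [OF i] \<rho>_le_\<mu> [of k] by simp
  next
    fix i assume "\<forall>i<\<rho> k. t i = 0" "\<rho> (k - 1) \<le> i \<and> i < \<rho> (k - 1) + \<rho> k"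
    then have "t (i - \<rho> (k - 1)) = 0" by auto
    then show "int (a k (i - \<rho> (k - 1))) * t (i - \<rho> (k - 1)) = 0" by simp
  qed
  finally show ?thesis .
qed

lemma E_mem_boundaries_iff:
  "E k t \<in> boundaries C k \<longleftrightarrow> (\<forall>i<\<rho> k. t i = 0) \<and>
     (\<forall>i<\<mu> k. int (if i < \<rho> (k + 1) then a (k + 1) i else 0) dvd t (\<rho> k + i))"
proof -
  let ?b = "\<lambda>s i. if \<rho> k \<le> i \<and> i < \<rho> k + \<rho> (k + 1) then int (a (k + 1) (i - \<rho> k)) * s (i - \<rho> k) else 0"
  have "boundaries C k = range (\<lambda>s. E k (?b s))"
    unfolding boundaries_def carrier_grp image_image bd_E add_diff_cancel_right' ..
  then have "E k t \<in> boundaries C k \<longleftrightarrow> (\<exists>s. \<forall>i<\<rho> k + \<mu> k. t i = ?b s i)"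
    by (auto simp: E_eq_iff)
  also have "\<dots> \<longleftrightarrow> (\<forall>i<\<rho> k. t i = 0) \<and>
     (\<forall>i<\<mu> k. int (if i < \<rho> (k + 1) then a (k + 1) i else 0) dvd t (\<rho> k + i))"
  proof (intro iffI conjI allI impI; (elim exE conjE)?)
    fix s i assume s: "\<forall>i<\<rho> k + \<mu> k. t i = ?b s i"
    show "t i = 0" if "i < \<rho> k" using s [rule_format, of i] that by simp
    show "int (if i < \<rho> (k + 1) then a (k + 1) i else 0) dvd t (\<rho> k + i)" if "i < \<mu> k"
      using s [rule_format, of "\<rho> k + i"] that by simp
  next
    assume z: "\<forall>i<\<rho> k. t i = 0"
      and dv: "\<forall>i<\<mu> k. int (if i < \<rho> (k + 1) then a (k + 1) i else 0) dvd t (\<rho> k + i)"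
    show "\<exists>s. \<forall>i<\<rho> k + \<mu> k. t i = ?b s i"
    proof (intro exI allI impI)
      fix i assume i: "i < \<rho> k + \<mu> k"
      show "t i = ?b (\<lambda>i. t (\<rho> k + i) div int (a (k + 1) i)) i"
      proof (cases "i < \<rho> k")
        case False
        then have "i - \<rho> k < \<mu> k" using i by simp
        then show ?thesis using dv False by (auto split: if_splits dest: spec [of _ "i - \<rho> k"])
      qed (use z in simp)
    qed
  qed
  finally show ?thesis .
qed

text \<open>The cycles are the elements whose first \<open>\<rho> k\<close> coordinates vanish, so the remaining \<open>\<mu> k\<close> coordinates
  describe them. The first \<open>\<rho> (k + 1)\<close> of these are defined modulo \<open>a (k + 1) i\<close>, by the boundaries.\<close>

lemma presents_homology:
  "presents (\<mu> k) (\<lambda>i. if i < \<rho> (k + 1) then a (k + 1) i else 0)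
     (\<lambda>t. boundaries C k #>\<^bsub>(grp C k)\<lparr>carrier := cycles C k\<rparr>\<^esub> E k (\<lambda>i. if i < \<rho> k then 0 else t (i - \<rho> k)))
     (homology C k)"
  and comm_group_homology: "comm_group (homology C k)"
proof -
  let ?Z = "(grp C k)\<lparr>carrier := cycles C k\<rparr>"
  interpret G: comm_group "grp C k" by (rule comm_group_grp)
  interpret d: group_hom "grp C k" "grp C (k - 1)" "bd C k"
    using group_grp bd_hom by (simp add: group_hom_def group_hom_axioms_def)
  interpret d': group_hom "grp C (k + 1)" "grp C k" "bd C (k + 1)"
    using group_grp bd_hom [of "k + 1"] by (simp add: group_hom_def group_hom_axioms_def)
  have Z: "subgroup (cycles C k) (grp C k)" unfolding cycles_def by (rule d.subgroup_kernel)
  have B: "subgroup (boundaries C k) (grp C k)" unfolding boundaries_def by (rule d'.img_is_subgroup)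
  have BZ: "boundaries C k \<subseteq> cycles C k"
  proof
    fix x assume x: "x \<in> boundaries C k"
    then obtain t where t: "x = E k t" using subgroup.mem_carrier [OF B] carrier_grp by auto
    show "x \<in> cycles C k" using x unfolding t E_mem_boundaries_iff E_mem_cycles_iff by blast
  qed
  have Z': "comm_group ?Z" 
    by (rule group.group_comm_groupI [OF G.subgroup_imp_group [OF Z]])
      (simp add: subgroup.mem_carrier [OF Z] G.m_comm)
  have B': "subgroup (boundaries C k) ?Z" by (rule G.subgroup_incl [OF B Z BZ])
  let ?\<tau> = "\<lambda>t. E k (\<lambda>i. if i < \<rho> k then 0 else t (i - \<rho> k))"
  show "presents (\<mu> k) (\<lambda>i. if i < \<rho> (k + 1) then a (k + 1) i else 0)
     (\<lambda>t. boundaries C k #>\<^bsub>?Z\<^esub> ?\<tau> t) (homology C k)"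
    unfolding homology_def
  proof (rule presents_FactGroup [OF Z' B'])
    show "range ?\<tau> = carrier ?Z"
    proof (intro subset_antisym subsetI)
      fix x assume x: "x \<in> carrier ?Z"
      then obtain t where t: "x = E k t" using subgroup.mem_carrier [OF Z] carrier_grp by auto
      have "\<forall>i<\<rho> k. t i = 0" using x E_mem_cycles_iff by (simp add: t)
      then have "x = ?\<tau> (\<lambda>i. t (\<rho> k + i))" unfolding t E_eq_iff by simp
      then show "x \<in> range ?\<tau>" by (rule range_eqI [where x = "\<lambda>i. t (\<rho> k + i)"])
    qed (auto simp: E_mem_cycles_iff)
  next
    fix s t :: "nat \<Rightarrow> int"
    have "?\<tau> (\<lambda>i. s i + t i) = E k (\<lambda>i. (if i < \<rho> k then 0 else s (i - \<rho> k)) + (if i < \<rho> k then 0 else t (i - \<rho> k)))"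
      by (simp add: E_eq_iff)
    then show "?\<tau> (\<lambda>i. s i + t i) = ?\<tau> s \<otimes>\<^bsub>?Z\<^esub> ?\<tau> t" by (simp add: E_add)
  qed (simp add: E_mem_boundaries_iff)
  show "comm_group (homology C k)"
    unfolding homology_def by (rule comm_group.abelian_FactGroup [OF Z' B'])
qed

text \<open>By \<open>presents_homology\<close>, the homology is a sum of groups \<open>\<int>/a\<close>, with \<open>a = 0\<close> for the cycles of which no
  multiple bounds. Comparison with the given decomposition yields \<open>p\<close> leading ones, followed by the given
  torsion coefficients and then by zeros; as the entries \<open>a (j + 1) i\<close> are positive for \<open>i < \<rho> (j + 1)\<close>, the
  zeros begin exactly at \<open>\<rho> (j + 1)\<close>.\<close>

theorem homology_determines:
  fixes d :: "nat \<Rightarrow> nat" and s \<beta> :: nat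
  assumes iso: "homology C j \<cong>
      sum_group {1..\<beta>} (\<lambda>_. integer_group) \<times>\<times> sum_group {1..s} (\<lambda>i. integer_mod_group (d i))"
    and d2: "\<And>i. i \<in> {1..s} \<Longrightarrow> 2 \<le> d i" and dv: "\<And>i. \<lbrakk>1 \<le> i; i < s\<rbrakk> \<Longrightarrow> d i dvd d (i + 1)"
  obtains p where "\<rho> (j + 1) = p + s" "\<mu> j = p + s + \<beta>"
    "\<And>i. i < p \<Longrightarrow> a (j + 1) i = 1" "\<And>i. i < s \<Longrightarrow> a (j + 1) (p + i) = d (i + 1)"
proof -
  let ?A = "sum_group {1..\<beta>} (\<lambda>_. integer_group)" and ?B = "sum_group {1..s} (\<lambda>i. integer_mod_group (d i))"
  let ?c = "\<lambda>i. if i < \<rho> (j + 1) then a (j + 1) i else 0" and ?c' = "\<lambda>i. if i < s then d (i + 1) else 0"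
  obtain h where h: "h \<in> iso (homology C j) (?A \<times>\<times> ?B)" using iso unfolding is_iso_def by blast
  have H: "group (homology C j)" using comm_group_homology by (simp add: comm_group_def)
  have AB: "group (?A \<times>\<times> ?B)" by (simp add: DirProd_group)
  have "presents (s + \<beta>) ?c' (inv_into (carrier (homology C j)) h \<circ> (\<lambda>t. (\<lambda>i\<in>{1..\<beta>}. t (s + i - 1), \<lambda>i\<in>{1..s}. t (i - 1) mod int (d i)))) (homology C j)"
    using d2 by (intro presents_iso [OF presents_sum_of_cyclic AB H group.iso_set_sym [OF H h]]) fastforce
  note \<pi>' = this
  have c: "?c i dvd ?c k" if "i \<le> k" "k < \<mu> j" for i k
    using that dvd_chain [of "\<mu> j" ?c i k] a_dvd_Suc by auto
  have c': "?c' i dvd ?c' k" if "i \<le> k" "k < s + \<beta>" for i k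
    using that dvd_chain [of "s + \<beta>" ?c' i k] dv by auto
  have c'1: "?c' i \<noteq> 1" if "i < s + \<beta>" for i using d2 [of "i + 1"] by auto
  obtain p where p: "\<mu> j = p + (s + \<beta>)" "\<And>i. i < p \<Longrightarrow> ?c i = 1" "\<And>i. i < s + \<beta> \<Longrightarrow> ?c (p + i) = ?c' i"
    by (rule presents_unique [OF comm_group_homology presents_homology \<pi>' c c' c'1];
        (assumption | rule that; assumption))
  have le: "\<rho> (j + 1) \<le> \<mu> j" using \<rho>_le_\<mu> [of "j + 1"] by simp
  have "\<not> \<rho> (j + 1) < p + s"
  proof
    assume l: "\<rho> (j + 1) < p + s"
    show False
    proof (cases "\<rho> (j + 1) < p")
      case True
      then show ?thesis using p(2) [of "\<rho> (j + 1)"] by simp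
    next
      case False
      then have "\<rho> (j + 1) - p < s" using l by simp
      then show ?thesis using p(3) [of "\<rho> (j + 1) - p"] d2 [of "\<rho> (j + 1) - p + 1"] False by simp
    qed
  qed
  moreover have "\<not> p + s < \<rho> (j + 1)"
  proof
    assume l: "p + s < \<rho> (j + 1)"
    then show False using p(1) p(3) [of s] a_pos [OF l] le by auto
  qed
  ultimately have \<rho>: "\<rho> (j + 1) = p + s" by simp
  show thesis
  proof
    show "a (j + 1) i = 1" if "i < p" for i using p(2) [OF that] that \<rho> by simp
    show "a (j + 1) (p + i) = d (i + 1)" if "i < s" for i using p(3) [of i] that \<rho> by simp
  qed (use p \<rho> in auto)
qed

end

section \<open>Tensor products with the rationals\<close>

lemma tensor_kernel_subgroup:
  assumes "group A" "group B"
  shows "subgroup (tensor_kernel A B) (free_Abelian_group (carrier A \<times> carrier B))"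
  unfolding tensor_kernel_def
proof (rule group.generate_is_subgroup [OF group_free_Abelian_group])
  have "Poly_Mapping.keys (frag_of p - frag_of q - frag_of r) \<subseteq> {p, q, r}" for p q r :: "'a \<times> 'c"
    using keys_diff [of "frag_of p - frag_of q" "frag_of r"] keys_diff [of "frag_of p" "frag_of q"] by auto
  moreover have "a \<otimes>\<^bsub>A\<^esub> a' \<in> carrier A" if "a \<in> carrier A" "a' \<in> carrier A" for a a'
    using assms(1) that by (simp add: group_def monoid.m_closed)
  moreover have "b \<otimes>\<^bsub>B\<^esub> b' \<in> carrier B" if "b \<in> carrier B" "b' \<in> carrier B" for b b'
    using assms(2) that by (simp add: group_def monoid.m_closed)
  ultimately show "tensor_relators A B \<subseteq> carrier (free_Abelian_group (carrier A \<times> carrier B))"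
    unfolding tensor_relators_def by (fastforce dest: subsetD)
qed

lemma
  assumes "group A" "group B"
  shows tensor_kernel_zero: "0 \<in> tensor_kernel A B"
    and tensor_kernel_add: "\<lbrakk>x \<in> tensor_kernel A B; y \<in> tensor_kernel A B\<rbrakk> \<Longrightarrow> x + y \<in> tensor_kernel A B"
    and tensor_kernel_keys: "x \<in> tensor_kernel A B \<Longrightarrow> Poly_Mapping.keys x \<subseteq> carrier A \<times> carrier B"
    and tensor_kernel_uminus: "x \<in> tensor_kernel A B \<Longrightarrow> - x \<in> tensor_kernel A B"
proof -
  interpret K: subgroup "tensor_kernel A B" "free_Abelian_group (carrier A \<times> carrier B)"
    using assms by (rule tensor_kernel_subgroup)
  show "0 \<in> tensor_kernel A B" using K.one_closed by simp
  show "x + y \<in> tensor_kernel A B" if "x \<in> tensor_kernel A B" "y \<in> tensor_kernel A B"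
    using K.m_closed [OF that] by simp
  show keys: "Poly_Mapping.keys x \<subseteq> carrier A \<times> carrier B" if "x \<in> tensor_kernel A B" for x
    using K.mem_carrier [OF that] by simp
  show "- x \<in> tensor_kernel A B" if "x \<in> tensor_kernel A B"
    using K.m_inv_closed [OF that] keys [OF that] by simp
qed

lemma tensor_kernel_diff:
  "\<lbrakk>group A; group B; x \<in> tensor_kernel A B; y \<in> tensor_kernel A B\<rbrakk> \<Longrightarrow> x - y \<in> tensor_kernel A B"
  using tensor_kernel_add tensor_kernel_uminus by (metis add_uminus_conv_diff)

lemma tensor_kernel_sum:
  "\<lbrakk>group A; group B; \<And>i. i \<in> I \<Longrightarrow> f i \<in> tensor_kernel A B\<rbrakk> \<Longrightarrow> sum f I \<in> tensor_kernel A B"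
  by (induction I rule: infinite_finite_induct) (auto simp: tensor_kernel_zero tensor_kernel_add)

lemma tensor_kernel_left:
  "\<lbrakk>a \<in> carrier A; a' \<in> carrier A; b \<in> carrier B\<rbrakk> \<Longrightarrow>
    frag_of (a \<otimes>\<^bsub>A\<^esub> a', b) - frag_of (a, b) - frag_of (a', b) \<in> tensor_kernel A B"
  unfolding tensor_kernel_def tensor_relators_def by (rule generate.incl) blast

lemma tensor_kernel_right:
  "\<lbrakk>a \<in> carrier A; b \<in> carrier B; b' \<in> carrier B\<rbrakk> \<Longrightarrow>
    frag_of (a, b \<otimes>\<^bsub>B\<^esub> b') - frag_of (a, b) - frag_of (a, b') \<in> tensor_kernel A B"
  unfolding tensor_kernel_def tensor_relators_def by (rule generate.incl) blast

text \<open>This reduces the verification that an additive map respects the tensor relations to the two kinds of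
  generators.\<close>

lemma tensor_kernel_induct [consumes 3, case_names left right zero add uminus]:
  assumes "group A" "group B" and x: "x \<in> tensor_kernel A B"
    and left: "\<And>a a' b. \<lbrakk>a \<in> carrier A; a' \<in> carrier A; b \<in> carrier B\<rbrakk> \<Longrightarrow>
        P (frag_of (a \<otimes>\<^bsub>A\<^esub> a', b) - frag_of (a, b) - frag_of (a', b))"
    and right: "\<And>a b b'. \<lbrakk>a \<in> carrier A; b \<in> carrier B; b' \<in> carrier B\<rbrakk> \<Longrightarrow>
        P (frag_of (a, b \<otimes>\<^bsub>B\<^esub> b') - frag_of (a, b) - frag_of (a, b'))"
    and zero: "P 0"
    and add: "\<And>x y. \<lbrakk>x \<in> tensor_kernel A B; y \<in> tensor_kernel A B; P x; P y\<rbrakk> \<Longrightarrow> P (x + y)"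
    and uminus: "\<And>x. \<lbrakk>x \<in> tensor_kernel A B; P x\<rbrakk> \<Longrightarrow> P (- x)"
  shows "P x"
proof -
  have rel: "P h" if "h \<in> tensor_relators A B" for h
    using that left right unfolding tensor_relators_def by auto
  have incl: "h \<in> tensor_kernel A B" if "h \<in> tensor_relators A B" for h
    using that unfolding tensor_kernel_def by (rule generate.incl)
  show ?thesis
    using x [unfolded tensor_kernel_def]
  proof (induction rule: generate.induct)
    case one
    then show ?case using zero by simp
  next
    case (incl h)
    then show ?case by (rule rel)
  next
    case (inv h)
    then have "inv\<^bsub>free_Abelian_group (carrier A \<times> carrier B)\<^esub> h = - h"
      by (intro inv_free_Abelian_group tensor_kernel_keys [OF assms(1,2)] incl)
    then show ?case using uminus [OF incl rel] inv by simp
  next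
    case (eng x y)
    then show ?case using add [unfolded tensor_kernel_def] by simp
  qed
qed

text \<open>The element of the tensor product that a formal sum of pairs represents.\<close>

definition tensor_class :: "'a monoid \<Rightarrow> 'b monoid \<Rightarrow> ('a \<times> 'b \<Rightarrow>\<^sub>0 int) \<Rightarrow> ('a \<times> 'b \<Rightarrow>\<^sub>0 int) set" where
  "tensor_class A B x = tensor_kernel A B #>\<^bsub>free_Abelian_group (carrier A \<times> carrier B)\<^esub> x"

lemma mem_tensor_class_iff:
  "y \<in> tensor_class A B x \<longleftrightarrow> y - x \<in> tensor_kernel A B"
proof -
  have "y \<in> tensor_class A B x \<longleftrightarrow> (\<exists>h\<in>tensor_kernel A B. y = h + x)"
    by (auto simp: tensor_class_def r_coset_def)
  then show ?thesis by (auto simp: algebra_simps intro!: bexI [of _ "y - x"])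
qed

lemma tensor_class_eq_iff:
  assumes "group A" "group B"
  shows "tensor_class A B x = tensor_class A B y \<longleftrightarrow> x - y \<in> tensor_kernel A B"
proof
  assume "tensor_class A B x = tensor_class A B y"
  moreover have "x \<in> tensor_class A B x" by (simp add: mem_tensor_class_iff tensor_kernel_zero assms)
  ultimately show "x - y \<in> tensor_kernel A B" using mem_tensor_class_iff by blast
next
  assume xy: "x - y \<in> tensor_kernel A B"
  have "z - x \<in> tensor_kernel A B \<longleftrightarrow> z - y \<in> tensor_kernel A B" for z
    using tensor_kernel_add [OF assms _ xy, of "z - x"] tensor_kernel_diff [OF assms _ xy, of "z - y"]
    by (auto simp: algebra_simps)
  then show "tensor_class A B x = tensor_class A B y" by (auto simp: mem_tensor_class_iff)
qed

lemma carrier_tensor_group: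
  "carrier (tensor_group A B) = tensor_class A B ` {x. Poly_Mapping.keys x \<subseteq> carrier A \<times> carrier B}"
  unfolding tensor_group_def carrier_FactGroup tensor_class_def by (simp add: free_Abelian_group_def)

lemma tensor_group_mult:
  assumes "group A" "group B" "Poly_Mapping.keys x \<subseteq> carrier A \<times> carrier B"
    "Poly_Mapping.keys y \<subseteq> carrier A \<times> carrier B"
  shows "tensor_class A B x \<otimes>\<^bsub>tensor_group A B\<^esub> tensor_class A B y = tensor_class A B (x + y)"
proof -
  interpret normal "tensor_kernel A B" "free_Abelian_group (carrier A \<times> carrier B)"
    by (rule comm_group.subgroup_imp_normal [OF abelian_free_Abelian_group tensor_kernel_subgroup [OF assms(1,2)]])
  show ?thesis using rcos_sum [of x y] assms(3,4) by (simp add: tensor_group_def tensor_class_def)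
qed

lemma tensor_group_one:
  "\<lbrakk>group A; group B\<rbrakk> \<Longrightarrow> \<one>\<^bsub>tensor_group A B\<^esub> = tensor_class A B 0"
  by (auto simp: tensor_group_def mem_tensor_class_iff)

text \<open>The induced map sends relators to relators. Hence all elements of the coset have images in the same
  coset, and the union in the definition of the tensor map is this single coset.\<close>

lemma tensor_map_class:
  assumes grp: "group A" "group B" "group A'" "group B'" and f: "f \<in> hom A A'" and g: "g \<in> hom B B'"
  shows "tensor_map A' B' f g (tensor_class A B x)
    = tensor_class A' B' (frag_extend (\<lambda>(a, b). frag_of (f a, g b)) x)"
proof -
  let ?m = "frag_extend (\<lambda>(a, b). frag_of (f a, g b))"
  have ker: "?m y \<in> tensor_kernel A' B'" if "y \<in> tensor_kernel A B" for y
    using grp(1,2) that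
  proof (induction rule: tensor_kernel_induct)
    case (left a a' b)
    then show ?case
      using f g by (simp add: frag_extend_diff hom_mult tensor_kernel_left hom_in_carrier)
  next
    case (right a b b')
    then show ?case
      using f g by (simp add: frag_extend_diff hom_mult tensor_kernel_right hom_in_carrier)
  qed (simp_all add: tensor_kernel_zero tensor_kernel_add tensor_kernel_uminus grp frag_extend_add frag_extend_minus)
  have "tensor_class A' B' (?m y) = tensor_class A' B' (?m x)" if "y \<in> tensor_class A B x" for y
    using ker that unfolding mem_tensor_class_iff tensor_class_eq_iff [OF grp(3,4)]
    by (simp flip: frag_extend_diff)
  moreover have "x \<in> tensor_class A B x" by (simp add: mem_tensor_class_iff tensor_kernel_zero grp)
  ultimately show ?thesis unfolding tensor_map_def tensor_class_def [symmetric] by blast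
qed

lemma group_rat_group: "group rat_group"
proof (rule groupI)
  show "\<exists>y\<in>carrier rat_group. y \<otimes>\<^bsub>rat_group\<^esub> x = \<one>\<^bsub>rat_group\<^esub>" for x
    by (rule bexI [of _ "- x"]) simp_all
qed simp_all

lemma tensor_kernel_rat_add:
  "a \<in> carrier A \<Longrightarrow> frag_of (a, p + q) - frag_of (a, p) - frag_of (a, q) \<in> tensor_kernel A rat_group"
  using tensor_kernel_right [of a A p rat_group q] by simp

text \<open>The vector space axioms for \<open>M\<close> are pulled back along \<open>T\<close>, so that they never have to be checked on
  tensors.\<close>

lemma dim_transport:
  assumes V: "vectorspace K V" "vectorspace.fin_dim K V" and T: "bij_betw T (carrier V) (carrier M)"
    and add: "\<And>v w. \<lbrakk>v \<in> carrier V; w \<in> carrier V\<rbrakk> \<Longrightarrow> T (v \<oplus>\<^bsub>V\<^esub> w) = T v \<oplus>\<^bsub>M\<^esub> T w"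
    and smult: "\<And>c v. \<lbrakk>c \<in> carrier K; v \<in> carrier V\<rbrakk> \<Longrightarrow> T (c \<odot>\<^bsub>V\<^esub> v) = c \<odot>\<^bsub>M\<^esub> T v"
    and zero: "T \<zero>\<^bsub>V\<^esub> = \<zero>\<^bsub>M\<^esub>"
  shows "vectorspace.dim K M = vectorspace.dim K V"
proof -
  interpret V: vectorspace K V by fact
  have M: "carrier M = T ` carrier V" using T by (simp add: bij_betw_def)
  have M_vs: "vectorspace K M"
  proof (rule vs_criteria)
    show "field K" by (rule V.field_axioms)
    show "\<forall>v\<in>carrier M. \<exists>w\<in>carrier M. v \<oplus>\<^bsub>M\<^esub> w = \<zero>\<^bsub>M\<^esub>"
      unfolding M by (auto simp: add [symmetric] zero [symmetric] intro!: bexI [of _ "\<ominus>\<^bsub>V\<^esub> _"] V.M.r_neg arg_cong [where f = T])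
  qed (auto simp: M add [symmetric] smult [symmetric] zero [symmetric] V.M.a_ac V.smult_assoc1
      V.smult_l_distr V.smult_r_distr)
  interpret linear_map K V M T
    unfolding linear_map_def mod_hom_def mod_hom_axioms_def LinearCombinations.module_hom_def
    using V(1) M_vs by (auto simp: vectorspace_def M add smult)
  show ?thesis using dim_eq [OF V(2)] T by (simp add: bij_betw_def)
qed

text \<open>Here a basis is given by the coordinate map \<open>E\<close>, with the unit sequences as coordinates of the
  basis elements.\<close>

locale free_presentation =
  fixes B :: "'b monoid" and n :: nat and E :: "(nat \<Rightarrow> int) \<Rightarrow> 'b"
  assumes comm_group: "comm_group B" and presents: "presents n (\<lambda>_. 0) E B"
begin

abbreviation "K \<equiv> tensor_kernel B rat_group"

text \<open>The formal sum of the pairs \<open>(e\<^sub>i, q\<^sub>i)\<close> for the basis elements \<open>e\<^sub>i\<close>; its class is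
  \<open>\<Sum> e\<^sub>i \<otimes> q\<^sub>i\<close>.\<close>

definition frag_comb :: "(nat \<Rightarrow> rat) \<Rightarrow> 'b \<times> rat \<Rightarrow>\<^sub>0 int" where
  "frag_comb q = (\<Sum>i<n. frag_of (E (\<lambda>j. if j = i then 1 else 0), q i))"

definition rat_comb :: "(nat \<Rightarrow> rat) \<Rightarrow> ('b \<times> rat \<Rightarrow>\<^sub>0 int) set" where
  "rat_comb q = tensor_class B rat_group (frag_comb q)"

lemma group_B: "group B"
  using comm_group by (simp add: comm_group_def)

lemmas group_B_rat = group_B group_rat_group

lemma carrier_B: "carrier B = range E"
  using presents unfolding presents_def by simp

lemma E_carrier: "E t \<in> carrier B"
  by (simp add: carrier_B)

lemma E_plus: "E (\<lambda>i. s i + t i) = E s \<otimes>\<^bsub>B\<^esub> E t"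
  using presents unfolding presents_def by simp

lemma E_cong: "(\<And>i. i < n \<Longrightarrow> s i = t i) \<Longrightarrow> E s = E t"
  by (simp add: presents_eq_iff [OF presents group_B])

lemma frag_of_E_keys: "Poly_Mapping.keys (frag_of (E t, q)) \<subseteq> carrier B \<times> UNIV"
  by (simp add: E_carrier)

lemma frag_comb_keys: "Poly_Mapping.keys (frag_comb q) \<subseteq> carrier B \<times> carrier rat_group"
  unfolding frag_comb_def using keys_sum E_carrier by fastforce

lemma frag_of_E_add: "frag_of (E (\<lambda>i. s i + t i), q) - frag_of (E s, q) - frag_of (E t, q) \<in> K"
  unfolding E_plus by (rule tensor_kernel_left) (auto simp: E_carrier)

lemma frag_comb_add: "frag_comb (\<lambda>i. p i + q i) - frag_comb p - frag_comb q \<in> K"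
  unfolding frag_comb_def sum_subtractf [symmetric]
  by (intro tensor_kernel_sum group_B_rat tensor_kernel_rat_add E_carrier)

lemma frag_of_E_zero: "frag_of (E (\<lambda>i. 0), q) \<in> K"
proof -
  have "- frag_of (E (\<lambda>i. 0), q) \<in> K" using frag_of_E_add [of "\<lambda>i. 0" "\<lambda>i. 0" q] by simp
  from tensor_kernel_uminus [OF group_B_rat this] show ?thesis by simp
qed

text \<open>That is, \<open>c e\<^sub>j \<otimes> q = e\<^sub>j \<otimes> c q\<close>. The difference \<open>Z c\<close> of the two sides is additive in \<open>c\<close>
  modulo the relations and vanishes for \<open>c = 1\<close>, so it remains in the kernel when \<open>c\<close> changes by one.\<close>

lemma frag_of_E_single:
  "frag_of (E (\<lambda>i. if i = j then c else 0), q) - frag_of (E (\<lambda>i. if i = j then 1 else 0), of_int c * q) \<in> K"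
proof -
  let ?e = "\<lambda>c i. if i = j then c else (0 :: int)"
  define Z where "Z c = frag_of (E (?e c), q) - frag_of (E (?e 1), of_int c * q)" for c
  have step: "Z (c + 1) - Z c \<in> K" for c
  proof -
    have e: "?e (c + 1) = (\<lambda>i. ?e c i + ?e 1 i)" by auto
    have q: "of_int (c + 1) * q = of_int c * q + q" by (simp add: algebra_simps)
    have "(frag_of (E (?e (c + 1)), q) - frag_of (E (?e c), q) - frag_of (E (?e 1), q)) -
        (frag_of (E (?e 1), of_int c * q + q) - frag_of (E (?e 1), of_int c * q) - frag_of (E (?e 1), q)) \<in> K"
      unfolding e
      by (rule tensor_kernel_diff [OF group_B_rat frag_of_E_add tensor_kernel_rat_add [OF E_carrier]])
    then show ?thesis unfolding Z_def q by (simp add: algebra_simps)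
  qed
  have "Z c \<in> K"
  proof (induction c rule: int_induct [where k = 0])
    case base
    have "frag_of (E (?e 1), 0) \<in> K"
    proof -
      have "- frag_of (E (?e 1), 0) \<in> K" using tensor_kernel_rat_add [OF E_carrier [of "?e 1"], of 0 0] by simp
      from tensor_kernel_uminus [OF group_B_rat this] show ?thesis by simp
    qed
    from tensor_kernel_diff [OF group_B_rat frag_of_E_zero [of q] this]
    show ?case by (simp add: Z_def)
  next
    case (step1 c)
    then show ?case using tensor_kernel_add [OF group_B_rat step [of c] step1(2)] by simp
  next
    case (step2 c)
    then show ?case using tensor_kernel_diff [OF group_B_rat step2(2) step [of "c - 1"]] by simp
  qed
  then show ?thesis by (simp add: Z_def)
qed

text \<open>Bilinearity expands \<open>(\<Sum> t\<^sub>i e\<^sub>i) \<otimes> q\<close> to \<open>\<Sum> e\<^sub>i \<otimes> t\<^sub>i q\<close>, adding one coordinate at a time.\<close>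

lemma frag_of_E_expand: "frag_of (E t, q) - frag_comb (\<lambda>i. of_int (t i) * q) \<in> K"
proof -
  have "frag_of (E (\<lambda>i. if i < m then t i else 0), q)
      - (\<Sum>i<m. frag_of (E (\<lambda>j. if j = i then 1 else 0), of_int (t i) * q)) \<in> K" for m
  proof (induction m)
    case 0
    show ?case using frag_of_E_zero by simp
  next
    case (Suc m)
    have e: "(\<lambda>i. if i < Suc m then t i else 0) = (\<lambda>i. (if i < m then t i else 0) + (if i = m then t m else 0))"
      by auto
    show ?case
      using tensor_kernel_add [OF group_B_rat tensor_kernel_add [OF group_B_rat Suc frag_of_E_single [of m "t m" q]]
          frag_of_E_add [of "\<lambda>i. if i < m then t i else 0" "\<lambda>i. if i = m then t m else 0" q]]
      unfolding e by (simp add: algebra_simps)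
  qed
  from this [of n] show ?thesis
    unfolding frag_comb_def using E_cong [of "\<lambda>i. if i < n then t i else 0" t] by simp
qed

lemma tensor_class_sum_E:
  fixes l :: nat
  shows "tensor_class B rat_group (\<Sum>j<l. frag_of (E (T j), q j)) = rat_comb (\<lambda>i. \<Sum>j<l. of_int (T j i) * q j)"
  unfolding rat_comb_def tensor_class_eq_iff [OF group_B_rat]
proof (induction l)
  case 0
  have "frag_comb (\<lambda>i. 0 + 0) - frag_comb (\<lambda>i. 0) - frag_comb (\<lambda>i. 0) \<in> K" by (rule frag_comb_add)
  then show ?case by simp
next
  case (Suc l)
  show ?case
    using tensor_kernel_diff [OF group_B_rat tensor_kernel_add [OF group_B_rat Suc frag_of_E_expand [of "T l" "q l"]]
        frag_comb_add [of "\<lambda>i. \<Sum>j<l. of_int (T j i) * q j" "\<lambda>i. of_int (T l i) * q l"]]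
    by (simp add: algebra_simps)
qed

lemma rat_comb_zero: "rat_comb (\<lambda>i. 0) = \<one>\<^bsub>tensor_group B rat_group\<^esub>"
  using tensor_class_sum_E [where l = 0] tensor_group_one [OF group_B_rat] by simp

lemma rat_comb_add: "rat_comb p \<otimes>\<^bsub>tensor_group B rat_group\<^esub> rat_comb q = rat_comb (\<lambda>i. p i + q i)"
  unfolding rat_comb_def tensor_group_mult [OF group_B_rat frag_comb_keys frag_comb_keys]
    tensor_class_eq_iff [OF group_B_rat]
  using tensor_kernel_uminus [OF group_B_rat frag_comb_add [of p q]] by (simp add: algebra_simps)

lemma carrier_tensor_rat: "carrier (tensor_group B rat_group) = range rat_comb"
proof -
  have "tensor_class B rat_group x \<in> range rat_comb" if "Poly_Mapping.keys x \<subseteq> carrier B \<times> carrier rat_group" for x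
    using that
  proof (induction x rule: free_Abelian_group_induct [consumes 1, case_names zero diff frag_of])
    case zero
    then show ?case using tensor_class_sum_E [where l = 0] by auto
  next
    case (diff x y)
    then obtain p q where "tensor_class B rat_group x = rat_comb p" "tensor_class B rat_group y = rat_comb q" by auto
    then have x: "x - frag_comb p \<in> K" and y: "y - frag_comb q \<in> K"
      unfolding rat_comb_def tensor_class_eq_iff [OF group_B_rat] by blast+
    have "tensor_class B rat_group (x - y) = rat_comb (\<lambda>i. p i - q i)"
      unfolding rat_comb_def tensor_class_eq_iff [OF group_B_rat]
      using tensor_kernel_add [OF group_B_rat tensor_kernel_diff [OF group_B_rat x y] frag_comb_add [of "\<lambda>i. p i - q i" q]]
      by (simp add: algebra_simps)
    then show ?case by blast
  next
    case (frag_of a)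
    then obtain t q where a: "a = (E t, q)" unfolding carrier_B by auto
    have "tensor_class B rat_group (frag_of a) = rat_comb (\<lambda>i. of_int (t i) * q)"
      unfolding a rat_comb_def tensor_class_eq_iff [OF group_B_rat] by (rule frag_of_E_expand)
    then show ?case by blast
  qed
  then show ?thesis unfolding carrier_tensor_group using frag_comb_keys by (auto simp: rat_comb_def)
qed

text \<open>The \<open>i\<close>-th coordinate of \<open>b \<otimes> q\<close> is the \<open>i\<close>-th coordinate of \<open>b\<close> times \<open>q\<close>. It extends to an additive
  map \<open>h\<close> on formal sums of pairs, which vanishes on the tensor relations and recovers the \<open>i\<close>-th
  coefficient of a combination.\<close>

lemma rat_comb_eq_iff: "rat_comb p = rat_comb q \<longleftrightarrow> (\<forall>i<n. p i = q i)"
proof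
  assume "\<forall>i<n. p i = q i"
  then show "rat_comb p = rat_comb q" by (simp add: rat_comb_def frag_comb_def)
next
  assume eq: "rat_comb p = rat_comb q"
  show "\<forall>i<n. p i = q i"
  proof (intro allI impI)
    fix i assume i: "i < n"
    define coord where "coord b = (SOME t. b = E t) i" for b
    have coord: "coord (E t) = t i" for t
    proof -
      have "E t = E (SOME s. E t = E s)" by (rule someI [of "\<lambda>s. E t = E s" t]) (rule refl)
      then show ?thesis using i unfolding coord_def presents_eq_iff [OF presents group_B] by simp
    qed
    let ?F = "free_Abelian_group (carrier B \<times> carrier rat_group)"
    have "comm_group rat_group" by (rule group.group_comm_groupI [OF group_rat_group]) simp
    then obtain h where h: "h \<in> hom ?F rat_group"
      "\<And>x. x \<in> carrier B \<times> carrier rat_group \<Longrightarrow> h (frag_of x) = of_int (coord (fst x)) * snd x"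
      using comm_group.free_Abelian_group_universal [of rat_group "\<lambda>x. of_int (coord (fst x)) * snd x" "carrier B \<times> carrier rat_group"]
      by auto
    interpret h: group_hom ?F rat_group h
      using h(1) group_rat_group by (simp add: group_hom_def group_hom_axioms_def)
    have h0: "h 0 = 0" using h.hom_one by simp
    have hadd: "h (x + y) = h x + h y" if "Poly_Mapping.keys x \<subseteq> carrier B \<times> UNIV"
        "Poly_Mapping.keys y \<subseteq> carrier B \<times> UNIV" for x y
      using h.hom_mult [of x y] that by simp
    have hminus: "h (- x) = - h x" if "Poly_Mapping.keys x \<subseteq> carrier B \<times> UNIV" for x
      using hadd [of x "- x"] that h0 by (simp add: eq_neg_iff_add_eq_0 add.commute)
    have hdiff: "h (x - y) = h x - h y" if "Poly_Mapping.keys x \<subseteq> carrier B \<times> UNIV"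
        "Poly_Mapping.keys y \<subseteq> carrier B \<times> UNIV" for x y
      using hadd [of x "- y"] hminus [of y] that by simp
    have hE: "h (frag_of (E t, q)) = of_int (t i) * q" for t q
      by (simp add: h(2) E_carrier coord)
    have keys_diff': "Poly_Mapping.keys (x - y) \<subseteq> S" if "Poly_Mapping.keys x \<subseteq> S" "Poly_Mapping.keys y \<subseteq> S"
      for x y :: "'b \<times> rat \<Rightarrow>\<^sub>0 int" and S
      using keys_diff [of x y] that by blast
    have hK: "h x = 0" if "x \<in> K" for x
      using group_B_rat that
    proof (induction rule: tensor_kernel_induct)
      case (left a a' b)
      then obtain s t where st: "a = E s" "a' = E t" unfolding carrier_B by auto
      show ?case
        unfolding st E_plus [symmetric]
        by (simp add: hdiff keys_diff' frag_of_E_keys hE del: keys_single) (simp add: algebra_simps)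
    next
      case (right a b b')
      then obtain t where t: "a = E t" unfolding carrier_B by auto
      show ?case
        unfolding t by (simp add: hdiff keys_diff' frag_of_E_keys hE del: keys_single) (simp add: algebra_simps)
    next
      case (add x y)
      then show ?case using hadd tensor_kernel_keys [OF group_B_rat, simplified] by simp
    next
      case (uminus x)
      then show ?case using hminus tensor_kernel_keys [OF group_B_rat, simplified] by simp
    qed (rule h0)
    have hc: "h (frag_comb q) = q i" for q
    proof -
      have "h (\<Sum>j<m. frag_of (E (\<lambda>k. if k = j then 1 else 0), q j)) = (if i < m then q i else 0)" for m
      proof (induction m)
        case (Suc m)
        have "Poly_Mapping.keys (\<Sum>j<m. frag_of (E (\<lambda>k. if k = j then 1 else 0), q j)) \<subseteq> carrier B \<times> UNIV"
          using keys_sum E_carrier by fastforce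
        then show ?case using Suc by (auto simp: hadd frag_of_E_keys hE less_Suc_eq simp del: keys_single)
      qed (simp add: h0)
      then show ?thesis using i by (simp add: frag_comb_def)
    qed
    have "frag_comb p - frag_comb q \<in> K"
      using eq unfolding rat_comb_def tensor_class_eq_iff [OF group_B_rat] .
    from hK [OF this] show "p i = q i" by (simp add: hdiff frag_comb_keys [simplified] hc)
  qed
qed

end


context smith_form begin

text \<open>In rational coordinates, the map induced by \<open>\<partial>\<^sub>k\<close> multiplies the \<open>i\<close>-th coordinate by the nonzero number
  \<open>a k i\<close> and moves it to position \<open>\<rho> (k - 1) + i\<close>, for \<open>i < \<rho> k\<close>. Its image thus consists of all vectors
  that are supported on these \<open>\<rho> k\<close> positions.\<close>

theorem rational_rank_bd: "rational_rank (grp C k) (grp C (k - 1)) (bd C k) = \<rho> k"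
proof -
  let ?A = "grp C k" and ?B = "grp C (k - 1)"
  interpret A: free_presentation ?A "\<rho> k + \<mu> k" "E k"
    by (rule free_presentation.intro [OF comm_group_grp presents_E])
  interpret B: free_presentation ?B "\<rho> (k - 1) + \<mu> (k - 1)" "E (k - 1)"
    by (rule free_presentation.intro [OF comm_group_grp presents_E])
  \<comment> \<open>\<open>J\<close> embeds \<open>\<rat>\<close>-vectors of length \<open>\<rho> k\<close> as those supported on the positions from \<open>\<rho> (k - 1)\<close> on\<close>
  define J where "J q j = (if \<rho> (k - 1) \<le> j \<and> j < \<rho> (k - 1) + \<rho> k then q (j - \<rho> (k - 1)) else 0)"
    for q :: "nat \<Rightarrow> rat" and j
  have map: "tensor_map ?B rat_group (bd C k) (\<lambda>x. x) (A.rat_comb q) = B.rat_comb (J (\<lambda>i. of_nat (a k i) * q i))" for q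
  proof -
    have id: "(\<lambda>x. x) \<in> hom rat_group rat_group" by (simp add: hom_def)
    have "tensor_map ?B rat_group (bd C k) (\<lambda>x. x) (A.rat_comb q)
        = tensor_class ?B rat_group (\<Sum>i<\<rho> k + \<mu> k. frag_of (bd C k (E k (\<lambda>j. if j = i then 1 else 0)), q i))"
      unfolding A.rat_comb_def tensor_map_class [OF A.group_B_rat B.group_B_rat bd_hom id]
      by (simp add: A.frag_comb_def frag_extend_sum o_def)
    also have "\<dots> = B.rat_comb (J (\<lambda>i. of_nat (a k i) * q i))"
      unfolding bd_E B.tensor_class_sum_E B.rat_comb_eq_iff
    proof (intro allI impI)
      fix i
      have "(\<Sum>j<\<rho> k + \<mu> k. of_int (int (a k l) * (if l = j then 1 else 0)) * q j) = of_nat (a k l) * q l"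
        if "l < \<rho> k" for l
        using that by (simp add: if_distrib [of "\<lambda>x. x * _"] if_distrib [of "\<lambda>x. _ * x"] if_distrib [of of_int] cong: if_cong)
      then show "(\<Sum>j<\<rho> k + \<mu> k. of_int (if \<rho> (k - 1) \<le> i \<and> i < \<rho> (k - 1) + \<rho> k
            then int (a k (i - \<rho> (k - 1))) * (if i - \<rho> (k - 1) = j then 1 else 0) else 0) * q j)
          = J (\<lambda>i. of_nat (a k i) * q i) i"
        by (auto simp: J_def)
    qed
    finally show ?thesis .
  qed
  define M where "M = (rationalization ?B)\<lparr>carrier :=
      tensor_map ?B rat_group (bd C k) (\<lambda>x. x) ` carrier (rationalization ?A)\<rparr>"
  have M: "carrier M = range (\<lambda>q. B.rat_comb (J q))"
  proof -
    have carrier: "carrier M = range (\<lambda>q. B.rat_comb (J (\<lambda>i. of_nat (a k i) * q i)))"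
      by (simp add: M_def rationalization_def A.carrier_tensor_rat [simplified] image_image map [simplified])
    have surj: "B.rat_comb (J q) = B.rat_comb (J (\<lambda>i. of_nat (a k i) * (q i / of_nat (a k i))))" for q
    proof -
      have "J q j = J (\<lambda>i. of_nat (a k i) * (q i / of_nat (a k i))) j" for j
      proof (cases "\<rho> (k - 1) \<le> j \<and> j < \<rho> (k - 1) + \<rho> k")
        case True
        then have "0 < a k (j - \<rho> (k - 1))" by (intro a_pos) auto
        then show ?thesis by (simp add: J_def)
      qed (auto simp: J_def)
      then show ?thesis unfolding B.rat_comb_eq_iff by blast
    qed
    show ?thesis
      unfolding carrier
    proof (intro subset_antisym image_subsetI)
      fix q
      show "B.rat_comb (J q) \<in> range (\<lambda>q. B.rat_comb (J (\<lambda>i. of_nat (a k i) * q i)))"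
        by (rule range_eqI [where x = "\<lambda>i. q i / of_nat (a k i)"]) (rule surj)
    qed (rule rangeI)
  qed
  have J_eq_iff: "B.rat_comb (J p) = B.rat_comb (J q) \<longleftrightarrow> (\<forall>i<\<rho> k. p i = q i)" for p q
  proof
    assume eq: "B.rat_comb (J p) = B.rat_comb (J q)"
    show "\<forall>i<\<rho> k. p i = q i"
    proof (intro allI impI)
      fix i assume i: "i < \<rho> k"
      then have "J p (\<rho> (k - 1) + i) = J q (\<rho> (k - 1) + i)"
        using eq \<rho>_le_\<mu> [of k] unfolding B.rat_comb_eq_iff by simp
      then show "p i = q i" using i by (simp add: J_def)
    qed
  next
    assume "\<forall>i<\<rho> k. p i = q i"
    then show "B.rat_comb (J p) = B.rat_comb (J q)"
      unfolding B.rat_comb_eq_iff by (auto simp: J_def)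
  qed
  interpret V: vec_space "TYPE(rat)" "\<rho> k" .
  let ?T = "\<lambda>v. B.rat_comb (J (\<lambda>i. v $ i))"
  have "vectorspace.dim class_ring M = vectorspace.dim class_ring (module_vec TYPE(rat) (\<rho> k))"
  proof (rule dim_transport [where T = ?T])
    show "vectorspace class_ring (module_vec TYPE(rat) (\<rho> k))" by (rule vec_vs)
    show "vectorspace.fin_dim class_ring (module_vec TYPE(rat) (\<rho> k))" by (rule V.fin_dim)
    show "bij_betw ?T (carrier (module_vec TYPE(rat) (\<rho> k))) (carrier M)"
    proof (rule bij_betw_imageI)
      show "inj_on ?T (carrier (module_vec TYPE(rat) (\<rho> k)))"
        by (auto simp: inj_on_def J_eq_iff module_vec_simps)
      show "?T ` carrier (module_vec TYPE(rat) (\<rho> k)) = carrier M"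
      proof (intro subset_antisym subsetI)
        fix x assume "x \<in> carrier M"
        then obtain q where x: "x = B.rat_comb (J q)" unfolding M by blast
        have "x = ?T (vec (\<rho> k) q)" unfolding x J_eq_iff by simp
        then show "x \<in> ?T ` carrier (module_vec TYPE(rat) (\<rho> k))" by (auto simp: module_vec_simps)
      qed (auto simp: M)
    qed
  next
    fix v w :: "rat vec"
    assume vw: "v \<in> carrier (module_vec TYPE(rat) (\<rho> k))" "w \<in> carrier (module_vec TYPE(rat) (\<rho> k))"
    have "?T v \<oplus>\<^bsub>M\<^esub> ?T w = B.rat_comb (\<lambda>i. J (($) v) i + J (($) w) i)"
      unfolding B.rat_comb_add [symmetric] by (simp add: M_def rationalization_def)
    also have "\<dots> = ?T (v + w)"
      using vw unfolding B.rat_comb_eq_iff by (auto simp: J_def module_vec_simps)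
    finally show "?T (v \<oplus>\<^bsub>module_vec TYPE(rat) (\<rho> k)\<^esub> w) = ?T v \<oplus>\<^bsub>M\<^esub> ?T w"
      by (simp add: module_vec_simps)
  next
    fix c :: rat and v :: "rat vec"
    assume v: "v \<in> carrier (module_vec TYPE(rat) (\<rho> k))"
    have id: "(\<lambda>x. x) \<in> hom ?B ?B" by (simp add: hom_def)
    have c: "(*) c \<in> hom rat_group rat_group" by (simp add: hom_def algebra_simps)
    have "c \<odot>\<^bsub>M\<^esub> B.rat_comb q = B.rat_comb (\<lambda>i. c * q i)" for q
      unfolding B.rat_comb_def using tensor_map_class [OF B.group_B_rat B.group_B_rat id c, of "B.frag_comb q"]
      by (simp add: M_def rationalization_def B.frag_comb_def frag_extend_sum o_def)
    then have "c \<odot>\<^bsub>M\<^esub> ?T v = B.rat_comb (\<lambda>i. c * J (($) v) i)" .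
    also have "\<dots> = ?T (c \<cdot>\<^sub>v v)"
      using v unfolding B.rat_comb_eq_iff by (auto simp: J_def module_vec_simps)
    finally show "?T (c \<odot>\<^bsub>module_vec TYPE(rat) (\<rho> k)\<^esub> v) = c \<odot>\<^bsub>M\<^esub> ?T v"
      by (simp add: module_vec_simps)
  next
    have "?T (0\<^sub>v (\<rho> k)) = B.rat_comb (\<lambda>i. 0)"
      unfolding B.rat_comb_eq_iff by (auto simp: J_def)
    then show "?T \<zero>\<^bsub>module_vec TYPE(rat) (\<rho> k)\<^esub> = \<zero>\<^bsub>M\<^esub>"
      unfolding B.rat_comb_zero by (simp add: M_def rationalization_def module_vec_simps)
  qed
  also have "\<dots> = \<rho> k" by (rule V.dim_is_n)
  finally show ?thesis unfolding rational_rank_def M_def .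
qed

end

section \<open>Sums of elementary complexes\<close>

text \<open>Both groups are the same quotient of the group of integer sequences.\<close>

lemma presents_same_imp_iso:
  assumes \<pi>: "presents n c \<pi> G" and \<pi>': "presents n c \<pi>' H" and G: "group G" and H: "group H"
  obtains f where "f \<in> iso G H" "\<And>t. f (\<pi> t) = \<pi>' t"
proof -
  define f where "f x = \<pi>' (SOME t. x = \<pi> t)" for x
  have f: "f (\<pi> t) = \<pi>' t" for t
  proof -
    have "\<pi> t = \<pi> (SOME s. \<pi> t = \<pi> s)" by (rule someI [of "\<lambda>s. \<pi> t = \<pi> s" t]) (rule refl)
    then show ?thesis
      unfolding f_def presents_eq_iff [OF \<pi> G] presents_eq_iff [OF \<pi>' H] by (simp add: dvd_diff_commute)
  qed
  have ran: "carrier G = range \<pi>" "carrier H = range \<pi>'"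
    using \<pi> \<pi>' unfolding presents_def by auto
  have add: "\<pi> s \<otimes>\<^bsub>G\<^esub> \<pi> t = \<pi> (\<lambda>i. s i + t i)" "\<pi>' s \<otimes>\<^bsub>H\<^esub> \<pi>' t = \<pi>' (\<lambda>i. s i + t i)" for s t
    using \<pi> \<pi>' unfolding presents_def by auto
  have "f \<in> iso G H"
    unfolding iso_iff ran
  proof (intro conjI inj_onI)
    show "f \<in> hom G H" by (rule homI) (auto simp: ran f add)
    show "f ` range \<pi> = range \<pi>'" unfolding image_image f ..
    fix x y assume "x \<in> range \<pi>" "y \<in> range \<pi>" "f x = f y"
    then show "x = y" by (auto simp: f presents_eq_iff [OF \<pi> G] presents_eq_iff [OF \<pi>' H])
  qed
  then show thesis using f by (rule that)
qed

text \<open>In each degree, only finitely many of the infinitely many summands of the elementary complexes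
  are nontrivial. Their direct sum is then the full product.\<close>

lemma carrier_sum_group_finite_support:
  assumes "\<And>i. i \<in> I \<Longrightarrow> group (G i)" "finite S"
    and triv: "\<And>i. i \<in> I - S \<Longrightarrow> carrier (G i) = {\<one>\<^bsub>G i\<^esub>}"
  shows "carrier (sum_group I G) = (\<Pi>\<^sub>E i\<in>I. carrier (G i))"
proof -
  have "finite {i \<in> I. x i \<noteq> \<one>\<^bsub>G i\<^esub>}" if "x \<in> (\<Pi>\<^sub>E i\<in>I. carrier (G i))" for x
  proof (rule finite_subset [OF _ assms(2)])
    show "{i \<in> I. x i \<noteq> \<one>\<^bsub>G i\<^esub>} \<subseteq> S"
    proof
      fix i assume "i \<in> {i \<in> I. x i \<noteq> \<one>\<^bsub>G i\<^esub>}"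
      then show "i \<in> S" using PiE_mem [OF that, of i] triv [of i] by auto
    qed
  qed
  moreover have "carrier (sum_group I G) = {x \<in> \<Pi>\<^sub>E i\<in>I. carrier (G i). finite {i \<in> I. x i \<noteq> \<one>\<^bsub>G i\<^esub>}}"
    by (rule carrier_sum_group [OF assms(1)])
  ultimately show ?thesis by blast
qed

lemma carrier_sum_group_finite:
  "\<lbrakk>finite I; \<And>i. i \<in> I \<Longrightarrow> group (G i)\<rbrakk> \<Longrightarrow> carrier (sum_group I G) = (\<Pi>\<^sub>E i\<in>I. carrier (G i))"
  by (rule carrier_sum_group_finite_support [where S = I]) auto

lemma grp_sum_complex: "grp (sum_complex I F) k = sum_group I (\<lambda>i. grp (F i) k)"
  and bd_sum_complex: "bd (sum_complex I F) k x = (\<lambda>i\<in>I. bd (F i) k (x i))"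
  by (simp_all add: sum_complex_def)

lemma grp_add_complex: "grp (C \<oplus>\<^sub>c D) k = grp C k \<times>\<times> grp D k"
  and bd_add_complex: "bd (C \<oplus>\<^sub>c D) k x = (bd C k (fst x), bd D k (snd x))"
  by (simp_all add: add_complex_def case_prod_beta)

lemma grp_copies: "grp (copies n C) k = sum_group {1..n} (\<lambda>_. grp C k)"
  and bd_copies: "bd (copies n C) k x = (\<lambda>i\<in>{1..n}. bd C k (x i))"
  by (simp_all add: copies_def grp_sum_complex bd_sum_complex)

lemma grp_Z_complex: "grp (Z_complex j) k = (if k = j then integer_group else singleton_group 0)"
  and bd_Z_complex: "bd (Z_complex j) k x = 0"
  by (simp_all add: Z_complex_def)

lemma grp_T_complex: "grp (T_complex l d) k = (if k = l - 1 \<or> k = l then integer_group else singleton_group 0)"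
  and bd_T_complex: "bd (T_complex l d) k x = (if k = l then int d * x else 0)"
  by (simp_all add: T_complex_def)

lemma mult_singleton_group: "x \<otimes>\<^bsub>singleton_group a\<^esub> y = a" and one_singleton_group: "\<one>\<^bsub>singleton_group a\<^esub> = a"
  by (simp_all add: singleton_group_def)

text \<open>The complex of the decomposition, in which \<open>p k\<close> is the number of summands \<open>T\<^sub>k(1)\<close>.\<close>

definition elementary_sum ::
    "(int \<Rightarrow> nat) \<Rightarrow> (int \<Rightarrow> nat) \<Rightarrow> (int \<Rightarrow> nat) \<Rightarrow> (int \<Rightarrow> nat \<Rightarrow> nat) \<Rightarrow>
     ((int \<Rightarrow> nat \<Rightarrow> int) \<times> (int \<Rightarrow> (nat \<Rightarrow> int) \<times> (nat \<Rightarrow> int))) chain_cx" where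
  "elementary_sum \<beta> s p d =
     sum_complex {0..} (\<lambda>j. copies (\<beta> j) (Z_complex j)) \<oplus>\<^sub>c
     sum_complex {1..} (\<lambda>k.
       sum_complex {1..s (k - 1)} (\<lambda>i. T_complex k (d (k - 1) i)) \<oplus>\<^sub>c
       copies (p k) (T_complex k 1))"

abbreviation Z_or_0 :: "bool \<Rightarrow> int monoid" where
  "Z_or_0 P \<equiv> (if P then integer_group else singleton_group 0)"

lemma grp_elementary_sum:
  "grp (elementary_sum \<beta> s p d) k =
     sum_group {0..} (\<lambda>j. sum_group {1..\<beta> j} (\<lambda>_. Z_or_0 (k = j))) \<times>\<times>
     sum_group {1..} (\<lambda>l. sum_group {1..s (l - 1)} (\<lambda>_. Z_or_0 (k = l - 1 \<or> k = l)) \<times>\<times>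
       sum_group {1..p l} (\<lambda>_. Z_or_0 (k = l - 1 \<or> k = l)))"
  by (simp add: elementary_sum_def grp_add_complex grp_sum_complex grp_copies grp_Z_complex grp_T_complex)

lemma group_elementary_sum: "group (grp (elementary_sum \<beta> s p d) k)"
  unfolding grp_elementary_sum by (intro DirProd_group sum_group) auto

lemma carrier_copies_Z_or_0:
  "carrier (sum_group {1..n::nat} (\<lambda>_. Z_or_0 P)) = {x \<in> extensional {1..n}. P \<or> (\<forall>i\<in>{1..n}. x i = 0)}"
  by (subst carrier_sum_group_finite) (auto simp: PiE_iff extensional_def restrict_def fun_eq_iff)

lemma carrier_elementary_sum:
  "(u, v) \<in> carrier (grp (elementary_sum \<beta> s p d) k) \<longleftrightarrow>
     u \<in> extensional {0..} \<and> v \<in> extensional {1..} \<and>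
     (\<forall>j\<ge>0. u j \<in> extensional {1..\<beta> j} \<and> (k = j \<or> (\<forall>i\<in>{1..\<beta> j}. u j i = 0))) \<and>
     (\<forall>l\<ge>1. fst (v l) \<in> extensional {1..s (l - 1)} \<and> snd (v l) \<in> extensional {1..p l} \<and>
       (k = l - 1 \<or> k = l \<or> (\<forall>i\<in>{1..s (l - 1)}. fst (v l) i = 0) \<and> (\<forall>i\<in>{1..p l}. snd (v l) i = 0)))"
proof -
  let ?A = "\<lambda>j. sum_group {1..\<beta> j} (\<lambda>_. Z_or_0 (k = j))"
  let ?B = "\<lambda>l. sum_group {1..s (l - 1)} (\<lambda>_. Z_or_0 (k = l - 1 \<or> k = l)) \<times>\<times>
       sum_group {1..p l} (\<lambda>_. Z_or_0 (k = l - 1 \<or> k = l))"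
  have ext0: "{x \<in> extensional I. \<forall>i\<in>I. x i = 0} = {\<lambda>i\<in>I. 0 :: int}" for I :: "nat set"
    by (auto simp: extensional_def restrict_def)
  have cu: "carrier (sum_group {0..} ?A) = (\<Pi>\<^sub>E j\<in>{0..}. carrier (?A j))"
  proof (rule carrier_sum_group_finite_support [where S = "{k}"])
    fix j assume "j \<in> {0..} - {k}"
    then have j: "k \<noteq> j" by auto
    show "carrier (?A j) = {\<one>\<^bsub>?A j\<^esub>}"
      unfolding carrier_copies_Z_or_0 using j by (simp add: ext0 one_singleton_group)
  qed auto
  have cv: "carrier (sum_group {1..} ?B) = (\<Pi>\<^sub>E l\<in>{1..}. carrier (?B l))"
  proof (rule carrier_sum_group_finite_support [where S = "{k, k + 1}"])
    fix l assume "l \<in> {1..} - {k, k + 1}"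
    then have l: "k \<noteq> l" "k \<noteq> l - 1" by auto
    show "carrier (?B l) = {\<one>\<^bsub>?B l\<^esub>}"
      unfolding carrier_DirProd carrier_copies_Z_or_0 using l
      by (simp add: ext0 one_DirProd one_singleton_group)
  qed (auto intro!: DirProd_group)
  have eu: "u \<in> (\<Pi>\<^sub>E j\<in>{0..}. carrier (?A j)) \<longleftrightarrow> u \<in> extensional {0..} \<and>
      (\<forall>j\<ge>0. u j \<in> extensional {1..\<beta> j} \<and> (k = j \<or> (\<forall>i\<in>{1..\<beta> j}. u j i = 0)))"
    unfolding PiE_iff carrier_copies_Z_or_0 mem_Collect_eq Ball_def atLeast_iff by blast
  have ev: "v \<in> (\<Pi>\<^sub>E l\<in>{1..}. carrier (?B l)) \<longleftrightarrow> v \<in> extensional {1..} \<and>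
      (\<forall>l\<ge>1. fst (v l) \<in> extensional {1..s (l - 1)} \<and> snd (v l) \<in> extensional {1..p l} \<and>
       (k = l - 1 \<or> k = l \<or> (\<forall>i\<in>{1..s (l - 1)}. fst (v l) i = 0) \<and> (\<forall>i\<in>{1..p l}. snd (v l) i = 0)))"
    unfolding PiE_iff carrier_DirProd mem_Times_iff carrier_copies_Z_or_0 mem_Collect_eq Ball_def atLeast_iff
    by blast
  show ?thesis
    unfolding grp_elementary_sum carrier_DirProd [of "sum_group {0..} ?A" "sum_group {1..} ?B"]
      cu cv mem_Sigma_iff eu ev
    by (rule iffI; elim conjE; intro conjI; assumption)
qed

lemma mult_elementary_sum:
  "(u, v) \<otimes>\<^bsub>grp (elementary_sum \<beta> s p d) k\<^esub> (u', v') =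
     (\<lambda>j\<in>{0..}. \<lambda>i\<in>{1..\<beta> j}. if k = j then u j i + u' j i else 0,
      \<lambda>l\<in>{1..}. (\<lambda>i\<in>{1..s (l - 1)}. if k = l - 1 \<or> k = l then fst (v l) i + fst (v' l) i else 0,
        \<lambda>i\<in>{1..p l}. if k = l - 1 \<or> k = l then snd (v l) i + snd (v' l) i else 0))"
  unfolding grp_elementary_sum
  by (auto simp: mult_DirProd' mult_singleton_group fun_eq_iff restrict_def)

lemma one_elementary_sum:
  "\<one>\<^bsub>grp (elementary_sum \<beta> s p d) k\<^esub> =
     (\<lambda>j\<in>{0..}. \<lambda>i\<in>{1..\<beta> j}. 0, \<lambda>l\<in>{1..}. (\<lambda>i\<in>{1..s (l - 1)}. 0, \<lambda>i\<in>{1..p l}. 0))"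
  unfolding grp_elementary_sum by (auto simp: one_DirProd one_singleton_group fun_eq_iff restrict_def)

lemma bd_elementary_sum:
  "bd (elementary_sum \<beta> s p d) k (u, v) =
     (\<lambda>j\<in>{0..}. \<lambda>i\<in>{1..\<beta> j}. 0,
      \<lambda>l\<in>{1..}. (\<lambda>i\<in>{1..s (l - 1)}. if k = l then int (d (l - 1) i) * fst (v l) i else 0,
        \<lambda>i\<in>{1..p l}. if k = l then snd (v l) i else 0))"
  by (auto simp: elementary_sum_def bd_add_complex bd_sum_complex bd_copies bd_Z_complex bd_T_complex
      fun_eq_iff restrict_def)

text \<open>A Smith basis whose entries \<open>a\<close> are matched with the invariants of the homology: in degree \<open>k\<close>, first
  \<open>p k\<close> ones and then the \<open>s (k - 1)\<close> torsion coefficients of degree \<open>k - 1\<close>.\<close>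

locale invariant_smith_form = smith_form +
  fixes \<beta> s p :: "int \<Rightarrow> nat" and d :: "int \<Rightarrow> nat \<Rightarrow> nat"
  assumes neg: "k < 0 \<Longrightarrow> \<rho> k = 0 \<and> \<mu> k = 0" and \<rho>_0: "\<rho> 0 = 0"
    and \<rho>_eq: "1 \<le> k \<Longrightarrow> \<rho> k = p k + s (k - 1)" and \<mu>_eq: "0 \<le> k \<Longrightarrow> \<mu> k = \<rho> (k + 1) + \<beta> k"
    and a_one: "\<lbrakk>1 \<le> k; i < p k\<rbrakk> \<Longrightarrow> a k i = 1"
    and a_d: "\<lbrakk>1 \<le> k; i < s (k - 1)\<rbrakk> \<Longrightarrow> a k (p k + i) = d (k - 1) (i + 1)"
begin

abbreviation "T \<equiv> elementary_sum \<beta> s p d"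

text \<open>The element of the elementary complex with the coordinates \<open>t\<close> in degree \<open>k\<close>. The coordinates below
  \<open>\<rho> k\<close> belong to the upper generators of the \<open>T\<^sub>k\<close>, first the copies of \<open>T\<^sub>k(1)\<close> and then the torsion
  summands. They are followed by those of the lower generators of the \<open>T\<^sub>k\<^sub>+\<^sub>1\<close> in the same order, and
  finally by those of the copies of \<open>\<int>[k]\<close>. Sequences start with index 0, but the summands are
  numbered from 1, hence the terms \<open>i - 1\<close>.\<close>

definition coeff_elem :: "int \<Rightarrow> (nat \<Rightarrow> int) \<Rightarrow> (int \<Rightarrow> nat \<Rightarrow> int) \<times> (int \<Rightarrow> (nat \<Rightarrow> int) \<times> (nat \<Rightarrow> int))" where
  "coeff_elem k t =
     (\<lambda>j\<in>{0..}. \<lambda>i\<in>{1..\<beta> j}. if k = j then t (\<rho> k + \<rho> (k + 1) + (i - 1)) else 0,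
      \<lambda>l\<in>{1..}.
       (\<lambda>i\<in>{1..s (l - 1)}. if k = l then t (p l + (i - 1)) else if k = l - 1 then t (\<rho> k + p l + (i - 1)) else 0,
        \<lambda>i\<in>{1..p l}. if k = l then t (i - 1) else if k = l - 1 then t (\<rho> k + (i - 1)) else 0))"

text \<open>Every coordinate below \<open>\<rho> k + \<mu> k\<close> occurs in exactly one summand, by the formulas for \<open>\<rho>\<close> and \<open>\<mu>\<close>.\<close>

lemma coeff_elem_eq_one_iff: "coeff_elem k t = \<one>\<^bsub>grp T k\<^esub> \<longleftrightarrow> (\<forall>i<\<rho> k + \<mu> k. t i = 0)"
proof
  assume "coeff_elem k t = \<one>\<^bsub>grp T k\<^esub>"
  then have Z: "\<And>j i. \<lbrakk>0 \<le> j; i \<in> {1..\<beta> j}\<rbrakk> \<Longrightarrow> (if k = j then t (\<rho> k + \<rho> (k + 1) + (i - 1)) else 0) = 0"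
    and S: "\<And>l i. \<lbrakk>1 \<le> l; i \<in> {1..s (l - 1)}\<rbrakk> \<Longrightarrow>
        (if k = l then t (p l + (i - 1)) else if k = l - 1 then t (\<rho> k + p l + (i - 1)) else 0) = 0"
    and P: "\<And>l i. \<lbrakk>1 \<le> l; i \<in> {1..p l}\<rbrakk> \<Longrightarrow>
        (if k = l then t (i - 1) else if k = l - 1 then t (\<rho> k + (i - 1)) else 0) = 0"
    unfolding coeff_elem_def one_elementary_sum prod.inject
    by (auto simp: fun_eq_iff restrict_def split: if_splits)
  show "\<forall>i<\<rho> k + \<mu> k. t i = 0"
  proof (intro allI impI)
    fix i assume i: "i < \<rho> k + \<mu> k"
    \<comment> \<open>the coordinates of the generators of \<open>T\<^sub>l\<close>, as they occur in degree \<open>l\<close> (with \<open>m = 0\<close>) and in degree \<open>l - 1\<close>\<close>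
    have low: "t (m + i) = 0" if "i < \<rho> l" "k = l \<and> m = 0 \<or> k = l - 1 \<and> m = \<rho> k" for i l m
    proof -
      have l: "1 \<le> l" using that(1) neg [of l] \<rho>_0 by (cases "l = 0") force+
      show ?thesis
      proof (cases "i < p l")
        case True
        then show ?thesis using P [OF l, of "i + 1"] that(2) by auto
      next
        case False
        then have "i - p l + 1 \<in> {1..s (l - 1)}" "p l + (i - p l) = i" using that(1) \<rho>_eq [OF l] by auto
        then show ?thesis using S [OF l, of "i - p l + 1"] that(2) by (auto simp: add.assoc)
      qed
    qed
    show "t i = 0"
    proof (cases "i < \<rho> k")
      case True
      then show ?thesis using low [of i k 0] by simp
    next
      case False
      then have k: "0 \<le> k" using i neg [of k] by force
      show ?thesis
      proof (cases "i < \<rho> k + \<rho> (k + 1)")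
        case True
        then show ?thesis using low [of "i - \<rho> k" "k + 1" "\<rho> k"] False by simp
      next
        case F: False
        then have "i - \<rho> k - \<rho> (k + 1) + 1 \<in> {1..\<beta> k}" using i \<mu>_eq [OF k] by auto
        from Z [OF k this] F show ?thesis by simp
      qed
    qed
  qed
next
  assume z: "\<forall>i<\<rho> k + \<mu> k. t i = 0"
  have "t (\<rho> k + \<rho> (k + 1) + (i - 1)) = 0" if "0 \<le> k" "i \<in> {1..\<beta> k}" for i
    using z \<mu>_eq [OF that(1)] that(2) by auto
  moreover have "t (p k + (i - 1)) = 0" if "1 \<le> k" "i \<in> {1..s (k - 1)}" for i
    using z \<rho>_eq [OF that(1)] that(2) by auto
  moreover have "t (i - 1) = 0" if "1 \<le> k" "i \<in> {1..p k}" for i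
    using z \<rho>_eq [OF that(1)] that(2) by auto
  moreover have "t (\<rho> k + p (k + 1) + (i - 1)) = 0" if "0 \<le> k" "i \<in> {1..s k}" for i
    using z \<mu>_eq [OF that(1)] \<rho>_eq [of "k + 1"] that by auto
  moreover have "t (\<rho> k + (i - 1)) = 0" if "0 \<le> k" "i \<in> {1..p (k + 1)}" for i
    using z \<mu>_eq [OF that(1)] \<rho>_eq [of "k + 1"] that by auto
  ultimately show "coeff_elem k t = \<one>\<^bsub>grp T k\<^esub>"
    unfolding coeff_elem_def one_elementary_sum prod.inject
    by (auto simp: fun_eq_iff restrict_def)
qed

lemma coeff_elem_surj:
  assumes "x \<in> carrier (grp T k)"
  shows "x \<in> range (coeff_elem k)"
proof -
  obtain u v where x: "x = (u, v)" by (cases x)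
  have u: "u \<in> extensional {0..}" and v: "v \<in> extensional {1..}"
    and Z: "\<And>j. 0 \<le> j \<Longrightarrow> u j \<in> extensional {1..\<beta> j} \<and> (k = j \<or> (\<forall>i\<in>{1..\<beta> j}. u j i = 0))"
    and S: "\<And>l. 1 \<le> l \<Longrightarrow> fst (v l) \<in> extensional {1..s (l - 1)} \<and>
        (k = l - 1 \<or> k = l \<or> (\<forall>i\<in>{1..s (l - 1)}. fst (v l) i = 0))"
    and P: "\<And>l. 1 \<le> l \<Longrightarrow> snd (v l) \<in> extensional {1..p l} \<and>
        (k = l - 1 \<or> k = l \<or> (\<forall>i\<in>{1..p l}. snd (v l) i = 0))"
    using assms unfolding x carrier_elementary_sum by blast+
  \<comment> \<open>the coordinates that belong to the generators of \<open>T\<^sub>l\<close>\<close>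
  define q where "q l i = (if i < p l then snd (v l) (i + 1) else fst (v l) (i - p l + 1))" for l i
  define t where "t i = (if i < \<rho> k then q k i else if i < \<rho> k + \<rho> (k + 1) then q (k + 1) (i - \<rho> k)
      else u k (i - \<rho> k - \<rho> (k + 1) + 1))" for i
  have t1: "t i = q k i" if "i < \<rho> k" for i using that by (simp add: t_def)
  have t2: "t (\<rho> k + i) = q (k + 1) i" if "i < \<rho> (k + 1)" for i using that by (simp add: t_def)
  have q1: "q l i = snd (v l) (i + 1)" if "i < p l" for l i using that by (simp add: q_def)
  have q2: "q l (p l + i) = fst (v l) (i + 1)" for l i by (simp add: q_def)
  have "coeff_elem k t = x"
    unfolding x coeff_elem_def
  proof (rule prod_eqI; unfold fst_conv snd_conv)
    show "(\<lambda>j\<in>{0..}. \<lambda>i\<in>{1..\<beta> j}. if k = j then t (\<rho> k + \<rho> (k + 1) + (i - 1)) else 0) = u"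
    proof (rule extensionalityI [OF restrict_extensional u])
      fix j :: int assume j: "j \<in> {0..}"
      have "(\<lambda>i\<in>{1..\<beta> j}. if k = j then t (\<rho> k + \<rho> (k + 1) + (i - 1)) else 0) = u j"
      proof (rule extensionalityI [OF restrict_extensional])
        show "u j \<in> extensional {1..\<beta> j}" using Z [of j] j by simp
        fix i assume "i \<in> {1..\<beta> j}"
        then show "(\<lambda>i\<in>{1..\<beta> j}. if k = j then t (\<rho> k + \<rho> (k + 1) + (i - 1)) else 0) i = u j i"
          using Z [of j] j by (auto simp: t_def)
      qed
      then show "(\<lambda>j\<in>{0..}. \<lambda>i\<in>{1..\<beta> j}. if k = j then t (\<rho> k + \<rho> (k + 1) + (i - 1)) else 0) j = u j"
        using j by simp
    qed
  next
    let ?s = "\<lambda>l. \<lambda>i\<in>{1..s (l - 1)}. if k = l then t (p l + (i - 1)) else if k = l - 1 then t (\<rho> k + p l + (i - 1)) else 0"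
    let ?p = "\<lambda>l. \<lambda>i\<in>{1..p l}. if k = l then t (i - 1) else if k = l - 1 then t (\<rho> k + (i - 1)) else 0"
    show "(\<lambda>l\<in>{1..}. (?s l, ?p l)) = v"
    proof (rule extensionalityI [OF restrict_extensional v])
      fix l :: int assume "l \<in> {1..}"
      then have l: "1 \<le> l" by simp
      have "?s l = fst (v l)"
      proof (rule extensionalityI [OF restrict_extensional])
        show "fst (v l) \<in> extensional {1..s (l - 1)}" using S [OF l] by simp
        fix i assume "i \<in> {1..s (l - 1)}"
        then have i: "i \<in> {1..s (l - 1)}" "p l + (i - 1) < \<rho> l" "i - 1 + 1 = i" using \<rho>_eq [OF l] by auto
        have val: "q l (p l + (i - 1)) = fst (v l) i" using q2 [of l "i - 1"] i by auto
        consider "k = l" | "k = l - 1" | "k \<noteq> l" "k \<noteq> l - 1" by blast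
        then show "?s l i = fst (v l) i"
        proof cases
          case 1
          then show ?thesis using t1 [of "p l + (i - 1)"] val i by simp
        next
          case 2
          then show ?thesis using t2 [of "p l + (i - 1)"] val i by (simp add: add.assoc)
        next
          case 3
          then show ?thesis using S [OF l] i by simp
        qed
      qed
      moreover have "?p l = snd (v l)"
      proof (rule extensionalityI [OF restrict_extensional])
        show "snd (v l) \<in> extensional {1..p l}" using P [OF l] by simp
        fix i assume "i \<in> {1..p l}"
        then have i: "i \<in> {1..p l}" "i - 1 < \<rho> l" "i - 1 + 1 = i" using \<rho>_eq [OF l] by auto
        have val: "q l (i - 1) = snd (v l) i" using q1 [of "i - 1" l] i by auto
        consider "k = l" | "k = l - 1" | "k \<noteq> l" "k \<noteq> l - 1" by blast
        then show "?p l i = snd (v l) i"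
        proof cases
          case 1
          then show ?thesis using t1 [of "i - 1"] val i by simp
        next
          case 2
          then show ?thesis using t2 [of "i - 1"] val i by (simp add: add.assoc)
        next
          case 3
          then show ?thesis using P [OF l] i by simp
        qed
      qed
      ultimately show "(\<lambda>l\<in>{1..}. (?s l, ?p l)) l = v l" using l by simp
    qed
  qed
  then show ?thesis by (metis rangeI)
qed

lemma presents_coeff_elem: "presents (\<rho> k + \<mu> k) (\<lambda>_. 0) (coeff_elem k) (grp T k)"
  unfolding presents_def
proof (intro conjI allI)
  show "range (coeff_elem k) = carrier (grp T k)"
  proof (intro subset_antisym subsetI)
    fix x assume "x \<in> range (coeff_elem k)"
    then obtain t where x: "x = coeff_elem k t" by blast
    show "x \<in> carrier (grp T k)"
      unfolding x coeff_elem_def carrier_elementary_sum by (intro conjI allI impI restrict_extensional) (simp_all, blast)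
  qed (rule coeff_elem_surj)
  show "coeff_elem k (\<lambda>i. t i + t' i) = coeff_elem k t \<otimes>\<^bsub>grp T k\<^esub> coeff_elem k t'" for t t'
    unfolding coeff_elem_def mult_elementary_sum by (auto simp: fun_eq_iff restrict_def)
  show "coeff_elem k t = \<one>\<^bsub>grp T k\<^esub> \<longleftrightarrow> (\<forall>i<\<rho> k + \<mu> k. int 0 dvd t i)" for t
    by (simp add: coeff_elem_eq_one_iff)
qed

text \<open>In degree \<open>k\<close>, only the summands of the \<open>T\<^sub>k\<close> have a nonzero differential; its factors are the
  entries of \<open>a k\<close> in their order.\<close>

lemma bd_coeff_elem:
  "bd T k (coeff_elem k t) = coeff_elem (k - 1) (\<lambda>i. if \<rho> (k - 1) \<le> i \<and> i < \<rho> (k - 1) + \<rho> k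
      then int (a k (i - \<rho> (k - 1))) * t (i - \<rho> (k - 1)) else 0)" (is "_ = coeff_elem _ ?t")
proof -
  have low: "?t i = 0" if "i < \<rho> (k - 1)" for i using that by simp
  have high: "?t (\<rho> (k - 1) + \<rho> (k - 1 + 1) + i) = 0" for i by simp
  show ?thesis
    unfolding coeff_elem_def bd_elementary_sum prod.inject
  proof (intro conjI restrict_ext)
    fix j :: int and i assume "i \<in> {1..\<beta> j}"
    show "0 = (if k - 1 = j then ?t (\<rho> (k - 1) + \<rho> (k - 1 + 1) + (i - 1)) else 0)"
      unfolding high by simp
  next
    fix l :: int assume l: "l \<in> {1..}"
    then have l1: "1 \<le> l" by simp
    let ?S = "\<lambda>i. if k = l then t (p l + (i - 1)) else if k = l - 1 then t (\<rho> k + p l + (i - 1)) else 0"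
    let ?P = "\<lambda>i. if k = l then t (i - 1) else if k = l - 1 then t (\<rho> k + (i - 1)) else 0"
    let ?S' = "\<lambda>i. if k - 1 = l then ?t (p l + (i - 1)) else if k - 1 = l - 1 then ?t (\<rho> (k - 1) + p l + (i - 1)) else 0"
    let ?P' = "\<lambda>i. if k - 1 = l then ?t (i - 1) else if k - 1 = l - 1 then ?t (\<rho> (k - 1) + (i - 1)) else 0"
    have S: "(if k = l then int (d (l - 1) i) * ?S i else 0) = ?S' i" if "i \<in> {1..s (l - 1)}" for i
    proof -
      obtain n where n: "i = Suc n" "n < s (l - 1)" using \<open>i \<in> {1..s (l - 1)}\<close> by (cases i) auto
      consider "k = l" | "k - 1 = l" | "k \<noteq> l" "k - 1 \<noteq> l" by blast
      then show ?thesis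
      proof cases
        case 1
        then show ?thesis using a_d [OF l1 n(2)] \<rho>_eq [OF l1] n by (simp add: add.assoc)
      next
        case 2
        then show ?thesis using low [of "p l + n"] \<rho>_eq [OF l1] n by simp
      qed simp
    qed
    have P: "(if k = l then ?P i else 0) = ?P' i" if "i \<in> {1..p l}" for i
    proof -
      obtain n where n: "i = Suc n" "n < p l" using \<open>i \<in> {1..p l}\<close> by (cases i) auto
      consider "k = l" | "k - 1 = l" | "k \<noteq> l" "k - 1 \<noteq> l" by blast
      then show ?thesis
      proof cases
        case 1
        then show ?thesis using a_one [OF l1 n(2)] \<rho>_eq [OF l1] n by simp
      next
        case 2
        then show ?thesis using low [of n] \<rho>_eq [OF l1] n by simp
      qed simp
    qed
    show "(\<lambda>i\<in>{1..s (l - 1)}. if k = l then int (d (l - 1) i) * fst ((\<lambda>l\<in>{1..}.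
        (\<lambda>i\<in>{1..s (l - 1)}. if k = l then t (p l + (i - 1)) else if k = l - 1 then t (\<rho> k + p l + (i - 1)) else 0,
         \<lambda>i\<in>{1..p l}. if k = l then t (i - 1) else if k = l - 1 then t (\<rho> k + (i - 1)) else 0)) l) i else 0,
       \<lambda>i\<in>{1..p l}. if k = l then snd ((\<lambda>l\<in>{1..}.
        (\<lambda>i\<in>{1..s (l - 1)}. if k = l then t (p l + (i - 1)) else if k = l - 1 then t (\<rho> k + p l + (i - 1)) else 0,
         \<lambda>i\<in>{1..p l}. if k = l then t (i - 1) else if k = l - 1 then t (\<rho> k + (i - 1)) else 0)) l) i else 0)
      = (\<lambda>i\<in>{1..s (l - 1)}. ?S' i, \<lambda>i\<in>{1..p l}. ?P' i)"
      unfolding prod.inject restrict_apply' [OF l] fst_conv snd_conv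
    proof (intro conjI restrict_ext)
      fix i assume i: "i \<in> {1..s (l - 1)}"
      show "(if k = l then int (d (l - 1) i) * (restrict ?S {1..s (l - 1)}) i else 0) = ?S' i"
        unfolding restrict_apply' [OF i] by (rule S [OF i])
    next
      fix i assume i: "i \<in> {1..p l}"
      show "(if k = l then (restrict ?P {1..p l}) i else 0) = ?P' i"
        unfolding restrict_apply' [OF i] by (rule P [OF i])
    qed
  qed
qed

theorem chain_isomorphic_elementary_sum: "C \<cong>\<^sub>c T"
proof -
  have "\<forall>k. \<exists>f. f \<in> iso (grp C k) (grp T k) \<and> (\<forall>t. f (E k t) = coeff_elem k t)"
    using presents_same_imp_iso [OF presents_E presents_coeff_elem group_grp group_elementary_sum] by metis
  then obtain f where f: "\<And>k. f k \<in> iso (grp C k) (grp T k)" "\<And>k t. f k (E k t) = coeff_elem k t" by metis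
  have "f (k - 1) (bd C k x) = bd T k (f k x)" if "x \<in> carrier (grp C k)" for k x
    using that unfolding carrier_grp by (auto simp: bd_E f(2) bd_coeff_elem)
  then have "f \<in> chain_iso C T" unfolding chain_iso_def using f(1) by blast
  then show ?thesis unfolding chain_isomorphic_def by blast
qed

end

theorem theorem4p2:
  fixes C :: "'a chain_cx"
    and \<beta> s r :: "int \<Rightarrow> nat"
    and d :: "int \<Rightarrow> nat \<Rightarrow> nat"
  assumes "chain_complex C"
    and "\<And>k. fg_free_abelian (grp C k)"
    and "bounded_complex C"
    and "nonneg_complex C"
    and "\<And>j. 0 \<le> j \<Longrightarrow>
           homology C j \<cong>
             sum_group {1..\<beta> j} (\<lambda>_. integer_group) \<times>\<times>
             sum_group {1..s j} (\<lambda>i. integer_mod_group (d j i))"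
    and "\<And>j i. 0 \<le> j \<Longrightarrow> i \<in> {1..s j} \<Longrightarrow> 2 \<le> d j i"
    and "\<And>j i. 0 \<le> j \<Longrightarrow> 1 \<le> i \<Longrightarrow> i < s j \<Longrightarrow> d j i dvd d j (i + 1)"
    and "\<And>k. r k = rational_rank (grp C k) (grp C (k - 1)) (bd C k)"
  shows "(\<forall>k\<ge>1. s (k - 1) \<le> r k) \<and>
    C \<cong>\<^sub>c
      sum_complex {0..} (\<lambda>j. copies (\<beta> j) (Z_complex j)) \<oplus>\<^sub>c
      sum_complex {1..} (\<lambda>k.
        sum_complex {1..s (k - 1)} (\<lambda>i. T_complex k (d (k - 1) i)) \<oplus>\<^sub>c
        copies (r k - s (k - 1)) (T_complex k 1))"
proof -
  obtain E \<rho> \<mu> a where sf: "smith_form C E \<rho> \<mu> a"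
    using smith_form_exists [OF assms(1,2)] by blast
  interpret smith_form C E \<rho> \<mu> a by (rule sf)
  have r: "r k = \<rho> k" for k using assms(8) rational_rank_bd by simp
  have neg: "\<rho> k = 0 \<and> \<mu> k = 0" if "k < 0" for k
  proof -
    have "carrier (grp C k) = {\<one>\<^bsub>grp C k\<^esub>}"
      using assms(4) that unfolding nonneg_complex_def trivial_group_def by blast
    then have "\<forall>i<\<rho> k + \<mu> k. (1 :: int) = 0" using E_mem [of k "\<lambda>_. 1"] E_eq_one_iff [of k "\<lambda>_. 1"] by simp
    then show ?thesis by auto
  qed
  have \<rho>_0: "\<rho> 0 = 0" using \<rho>_le_\<mu> [of 0] neg [of "-1"] by simp
  have inv: "s (k - 1) \<le> \<rho> k \<and> \<mu> (k - 1) = \<rho> k + \<beta> (k - 1) \<and>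
      (\<forall>i<\<rho> k - s (k - 1). a k i = 1) \<and> (\<forall>i<s (k - 1). a k (\<rho> k - s (k - 1) + i) = d (k - 1) (i + 1))"
    if "1 \<le> k" for k
  proof -
    have k: "0 \<le> k - 1" "k - 1 + 1 = k" using that by auto
    obtain p where "\<rho> k = p + s (k - 1)" "\<mu> (k - 1) = p + s (k - 1) + \<beta> (k - 1)"
      "\<And>i. i < p \<Longrightarrow> a k i = 1" "\<And>i. i < s (k - 1) \<Longrightarrow> a k (p + i) = d (k - 1) (i + 1)"
      by (rule homology_determines [OF assms(5) [OF k(1)] assms(6) [OF k(1)] assms(7) [OF k(1)],
          unfolded k(2)]; (assumption | rule that; assumption))
    then show ?thesis by auto
  qed
  interpret invariant_smith_form C E \<rho> \<mu> a \<beta> s "\<lambda>k. \<rho> k - s (k - 1)" d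
  proof
    show "\<mu> k = \<rho> (k + 1) + \<beta> k" if "0 \<le> k" for k using inv [of "k + 1"] that by simp
    show "a k (\<rho> k - s (k - 1) + i) = d (k - 1) (i + 1)" if "1 \<le> k" "i < s (k - 1)" for k i
      using inv [OF that(1)] that(2) by blast
  qed (use neg \<rho>_0 inv in auto)
  show ?thesis
    using chain_isomorphic_elementary_sum inv unfolding elementary_sum_def r by blast
qed

end
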